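(* Let $d\ge 1$ and let $\{T^z\}_{z\in\mathbb{Z}^d}$ be a free ergodic action of $\mathbb{Z}^d$ by automorphisms of a probability space $(X,\mu)$. Let $d_j:X\to\mathbb{R}$, $j\ge 1$, be a sequence of functions with $\|d_j\|_1=1$, and for each $j$ let $U_j$ be any weak-$*$ neighbourhood of the distribution $\pi(d_j)$. Then there exist a function $f\in L_1(X,\mu)$ with $\int_X f\,d\mu=0$ and a rapidly growing sequence of positive integers $N_1<N_2<\cdots$ such that for every $j\ge 1$ $$\pi\left(\frac{P_{N_j}f}{\|P_{N_j}f\|_1}\right)\in U_j ,$$ that is, the distributions of the values of the normalized averages $P_{N_j}f/\|P_{N_j}f\|_1$ are as close as we wish to the distributions $\pi(d_j)$.
   Context: For $N\ge 1$ put $Q_N=\{z=(z_1,\dots,z_d)\in\mathbb{Z}^d : 1\le z_1,\dots,z_d\le N\}$ and, for $f\in L_1(X,\mu)$, $P_Nf(x)=N^{-d}\sum_{z\in Q_N} f(T^zx)$. Here $\|\cdot\|_1$ is the norm of $L_1(X,\mu)$. The distribution $\pi(g)$ of the values of a function $g:X\to\mathbb{R}$ is the projection onto $\mathbb{R}$ of the measure obtained by lifting $\mu$ to the graph $\{(x,g(x)):x\in X\}$, i.e. $\pi(g)(A)=\mu(g^{-1}(A))$. Closeness of distributions is understood as closeness, in the weak-$*$ sense, of the corresponding functionals on $C_0(\mathbb{R})$, the continuous functions on $\mathbb{R}$ vanishing at infinity. The action is free if for $\mu$-almost every $x$ one has $T^zx\ne x$ for all $z\ne 0$.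
   Formalization: Each d_j is also assumed to have integral 0 (otherwise false: for d_1=1 no mean-zero f can give distributions near the point mass at 1), and the probability space is taken to be a Lebesgue (standard) space, as is customary and needed for pointwise freeness to be meaningful. *)

theory Defs
  imports "HOL-Probability.Probability"
begin

section \<open>Lebesgue spaces\<close>

definition iso_mod0 :: "'a measure \<Rightarrow> 'b measure \<Rightarrow> bool" where
  "iso_mod0 A B \<longleftrightarrow>
     (\<exists>X0\<in>sets A. \<exists>Y0\<in>sets B. \<exists>h.
        emeasure A (space A - X0) = 0 \<and> emeasure B (space B - Y0) = 0 \<and>
        bij_betw h X0 Y0 \<and>
        h \<in> restrict_space A X0 \<rightarrow>\<^sub>M restrict_space B Y0 \<and>
        the_inv_into X0 h \<in> restrict_space B Y0 \<rightarrow>\<^sub>M restrict_space A X0 \<and>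
        (\<forall>S\<in>sets B. S \<subseteq> Y0 \<longrightarrow> emeasure A (h -` S \<inter> X0) = emeasure B S))"

text \<open>
  Automorphisms and pointwise freeness are meant in the setting of Lebesgue (standard
  probability) spaces. Because both sides are completed, the definition covers standard Borel
  probability spaces as well as complete Lebesgue-Rokhlin spaces. Some such condition is
  indispensable: on a single infinite orbit with the trivial sigma-algebra the action is
  pointwise free and ergodic although all measurable functions are constant.
\<close>

definition lebesgue_prob_space :: "'a measure \<Rightarrow> bool" where
  "lebesgue_prob_space M \<longleftrightarrow> prob_space M \<and>
     (\<exists>\<nu>::real measure. prob_space \<nu> \<and> sets \<nu> = sets borel \<and>
        iso_mod0 (completion M) (completion \<nu>))"

section \<open>Actions of the lattice of integer vectors\<close>

text \<open>Every \<^term>\<open>T z\<close> is automatically invertible, with inverse \<^term>\<open>T (- z)\<close>.\<close>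

definition zd_action :: "'a measure \<Rightarrow> (int ^ 'd \<Rightarrow> 'a \<Rightarrow> 'a) \<Rightarrow> bool" where
  "zd_action M T \<longleftrightarrow>
     (\<forall>z. T z \<in> M \<rightarrow>\<^sub>M M \<and> distr M M (T z) = M) \<and>
     (\<forall>x\<in>space M. T 0 x = x) \<and>
     (\<forall>z w. \<forall>x\<in>space M. T (z + w) x = T z (T w x))"

definition free_action :: "'a measure \<Rightarrow> (int ^ 'd \<Rightarrow> 'a \<Rightarrow> 'a) \<Rightarrow> bool" where
  "free_action M T \<longleftrightarrow> (AE x in M. \<forall>z. z \<noteq> 0 \<longrightarrow> T z x \<noteq> x)"

definition ergodic_action :: "'a measure \<Rightarrow> (int ^ 'd \<Rightarrow> 'a \<Rightarrow> 'a) \<Rightarrow> bool" where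
  "ergodic_action M T \<longleftrightarrow>
     (\<forall>A\<in>sets M. (\<forall>z. T z -` A \<inter> space M = A) \<longrightarrow> measure M A = 0 \<or> measure M A = 1)"

definition cube :: "nat \<Rightarrow> (int ^ 'd) set" where
  "cube N = {z. \<forall>i. 1 \<le> z $ i \<and> z $ i \<le> int N}"

definition average :: "(int ^ 'd \<Rightarrow> 'a \<Rightarrow> 'a) \<Rightarrow> nat \<Rightarrow> ('a \<Rightarrow> real) \<Rightarrow> 'a \<Rightarrow> real" where
  "average T N f x = (\<Sum>z\<in>cube N. f (T z x)) / real N ^ CARD('d)"

definition L1_norm :: "'a measure \<Rightarrow> ('a \<Rightarrow> real) \<Rightarrow> real" where
  "L1_norm M g = (\<integral>x. \<bar>g x\<bar> \<partial>M)"

section \<open>Distributions and the weak-star topology\<close>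

definition distribution :: "'a measure \<Rightarrow> ('a \<Rightarrow> real) \<Rightarrow> real measure" where
  "distribution M g = distr M borel g"

definition C0 :: "(real \<Rightarrow> real) set" where
  "C0 = {\<phi>. continuous_on UNIV \<phi> \<and> (\<phi> \<longlongrightarrow> 0) at_infinity}"

text \<open>
  Functionals are only meaningful on \<^term>\<open>C0\<close>; they are made \<^term>\<open>undefined\<close> elsewhere, so that
  the weak-star topology (pointwise convergence on \<^term>\<open>C0\<close>) is the one inherited from the product.
\<close>

definition C0_dual :: "((real \<Rightarrow> real) \<Rightarrow> real) set" where
  "C0_dual = {L \<in> extensional C0.
     (\<forall>\<phi>\<in>C0. \<forall>\<psi>\<in>C0. L (\<lambda>t. \<phi> t + \<psi> t) = L \<phi> + L \<psi>) \<and>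
     (\<forall>c. \<forall>\<phi>\<in>C0. L (\<lambda>t. c * \<phi> t) = c * L \<phi>) \<and>
     (\<exists>B. \<forall>\<phi>\<in>C0. \<bar>L \<phi>\<bar> \<le> B * (SUP t. \<bar>\<phi> t\<bar>))}"

definition weak_star :: "((real \<Rightarrow> real) \<Rightarrow> real) topology" where
  "weak_star = subtopology (product_topology (\<lambda>_. euclideanreal) C0) C0_dual"

definition C0_functional :: "real measure \<Rightarrow> (real \<Rightarrow> real) \<Rightarrow> real" where
  "C0_functional \<nu> = (\<lambda>\<phi>\<in>C0. \<integral>t. \<phi> t \<partial>\<nu>)"

definition weak_star_nbhd :: "((real \<Rightarrow> real) \<Rightarrow> real) set \<Rightarrow> real measure \<Rightarrow> bool" where
  "weak_star_nbhd U \<nu> \<longleftrightarrow>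
     U \<subseteq> C0_dual \<and> (\<exists>V. openin weak_star V \<and> C0_functional \<nu> \<in> V \<and> V \<subseteq> U)"

section \<open>Distributions of functions with integral zero\<close>

lemma C0_abs_le_SUP:
  assumes "\<phi> \<in> C0"
  shows "\<bar>\<phi> t\<bar> \<le> (SUP t. \<bar>\<phi> t\<bar>)"
proof -
  have c: "continuous_on UNIV \<phi>" and l: "(\<phi> \<longlongrightarrow> 0) at_infinity"
    using assms by (auto simp: C0_def)
  from l have "\<forall>\<^sub>F t in at_infinity. dist (\<phi> t) 0 < 1"
    by (rule tendstoD) simp
  then obtain b where b: "\<And>t. norm t \<ge> b \<Longrightarrow> \<bar>\<phi> t\<bar> < 1"
    by (auto simp: eventually_at_infinity)
  have "compact (\<phi> ` cball 0 b)"
    by (intro compact_continuous_image continuous_on_subset[OF c]) auto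
  then obtain B where B: "\<And>t. t \<in> cball 0 b \<Longrightarrow> \<bar>\<phi> t\<bar> \<le> B"
    by (metis compact_imp_bounded bounded_iff imageI real_norm_def)
  have "bdd_above (range (\<lambda>t. \<bar>\<phi> t\<bar>))"
  proof (rule bdd_aboveI2)
    fix t show "\<bar>\<phi> t\<bar> \<le> max 1 B"
      using b[of t] B[of t] by (cases "norm t \<ge> b") auto
  qed
  then show ?thesis by (intro cSUP_upper) auto
qed

lemma C0_functional_in_dual:
  assumes "prob_space \<nu>" "sets \<nu> = sets borel"
  shows "C0_functional \<nu> \<in> C0_dual"
proof -
  interpret prob_space \<nu> by fact
  have int: "integrable \<nu> \<phi>" if "\<phi> \<in> C0" for \<phi>
  proof (rule integrable_const_bound[where B = "SUP t. \<bar>\<phi> t\<bar>"])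
    show "AE x in \<nu>. norm (\<phi> x) \<le> (SUP t. \<bar>\<phi> t\<bar>)" using C0_abs_le_SUP[OF that] by simp
    have "\<phi> \<in> borel_measurable borel"
      using that by (intro borel_measurable_continuous_onI) (simp add: C0_def)
    then show "\<phi> \<in> borel_measurable \<nu>"
      by (simp add: measurable_cong_sets[OF assms(2) refl])
  qed
  have add: "(\<lambda>t. \<phi> t + \<psi> t) \<in> C0" if "\<phi> \<in> C0" "\<psi> \<in> C0" for \<phi> \<psi>
    using that tendsto_add[of \<phi> 0 at_infinity \<psi> 0] by (auto simp: C0_def intro: continuous_on_add)
  have scale: "(\<lambda>t. c * \<phi> t) \<in> C0" if "\<phi> \<in> C0" for c \<phi>
    using that by (auto simp: C0_def intro: continuous_on_mult_left tendsto_mult_right_zero)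
  have bnd: "\<bar>\<integral>t. \<phi> t \<partial>\<nu>\<bar> \<le> (SUP t. \<bar>\<phi> t\<bar>)" if "\<phi> \<in> C0" for \<phi>
  proof -
    have "\<bar>\<integral>t. \<phi> t \<partial>\<nu>\<bar> \<le> (\<integral>t. \<bar>\<phi> t\<bar> \<partial>\<nu>)" by (rule integral_abs_bound)
    also have "\<dots> \<le> (\<integral>t. (SUP t. \<bar>\<phi> t\<bar>) \<partial>\<nu>)"
      using int[OF that] C0_abs_le_SUP[OF that] by (intro integral_mono) auto
    finally show ?thesis by (simp add: prob_space)
  qed
  show ?thesis
    unfolding C0_dual_def C0_functional_def
    using add scale int bnd by (auto intro!: exI[of _ 1])
qed

definition hat :: "nat \<Rightarrow> real \<Rightarrow> real" where
  "hat K t = max 0 (min t (real K - t))"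

lemma hat_C0: "s \<noteq> 0 \<Longrightarrow> (\<lambda>t. hat K (s * t)) \<in> C0"
proof -
  assume s: "s \<noteq> 0"
  have "\<forall>\<^sub>F t in at_infinity. hat K (s * t) = 0"
    unfolding eventually_at_infinity
  proof (intro exI allI impI)
    fix t :: real assume "real K / \<bar>s\<bar> \<le> norm t"
    then have "real K \<le> \<bar>s * t\<bar>" using s by (simp add: field_simps abs_mult)
    moreover have "hat K u = 0" if "real K \<le> \<bar>u\<bar>" for u
      using that by (auto simp: hat_def max_def min_def abs_if split: if_splits)
    ultimately show "hat K (s * t) = 0" by blast
  qed
  then have "((\<lambda>t. hat K (s * t)) \<longlongrightarrow> 0) at_infinity" by (rule tendsto_eventually)
  moreover have "continuous_on UNIV (\<lambda>t. hat K (s * t))"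
    unfolding hat_def by (intro continuous_intros)
  ultimately show ?thesis by (simp add: C0_def)
qed

lemma pos_part_le_half:
  assumes M: "prob_space M" and d: "integrable M d" and s: "\<bar>s\<bar> = 1"
    and approx: "\<And>U. weak_star_nbhd U (distribution M d) \<Longrightarrow>
      \<exists>g. integrable M g \<and> (\<integral>x. g x \<partial>M) = 0 \<and> L1_norm M g = 1 \<and>
          C0_functional (distribution M g) \<in> U"
  shows "(\<integral>x. max 0 (s * d x) \<partial>M) \<le> 1/2"
proof (rule ccontr)
  interpret prob_space M by fact
  have fn: "C0_functional (distribution M g) (\<lambda>t. hat K (s * t)) = (\<integral>x. hat K (s * g x) \<partial>M)"
    if "integrable M g" for g K
    using that s hat_C0[of s K] unfolding C0_functional_def distribution_def
    by (simp, subst integral_distr) (auto simp: hat_def)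
  assume "\<not> ?thesis"
  then have gt: "1/2 < (\<integral>x. max 0 (s * d x) \<partial>M)" by simp
  have "(\<lambda>K. \<integral>x. hat K (s * d x) \<partial>M) \<longlonglongrightarrow> (\<integral>x. max 0 (s * d x) \<partial>M)"
  proof (rule integral_dominated_convergence[where w = "\<lambda>x. \<bar>d x\<bar>"])
    show "AE x in M. (\<lambda>K. hat K (s * d x)) \<longlonglongrightarrow> max 0 (s * d x)"
    proof (rule AE_I2, rule tendsto_eventually)
      fix x
      obtain K0 :: nat where "2 * (s * d x) \<le> real K0" using real_arch_simple by blast
      then show "\<forall>\<^sub>F K in sequentially. hat K (s * d x) = max 0 (s * d x)"
        unfolding eventually_sequentially
        by (intro exI[of _ K0]) (auto simp: hat_def max_def min_def)
    qed
    show "AE x in M. norm (hat K (s * d x)) \<le> \<bar>d x\<bar>" for K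
      using s by (intro AE_I2) (auto simp: hat_def max_def min_def abs_if split: if_splits)
  qed (use d in \<open>auto simp: hat_def\<close>)
  from order_tendstoD(1)[OF this gt] obtain K where K: "1/2 < (\<integral>x. hat K (s * d x) \<partial>M)"
    by (auto simp: eventually_sequentially)
  define \<phi> where "\<phi> = (\<lambda>t. hat K (s * t))"
  have \<phi>: "\<phi> \<in> C0" using hat_C0[of s K] s by (auto simp: \<phi>_def)
  define U where "U = {L \<in> C0_dual. 1/2 < L \<phi>}"
  have "openin (product_topology (\<lambda>_. euclideanreal) C0)
      {L \<in> topspace (product_topology (\<lambda>_. euclideanreal) C0). L \<phi> \<in> {1/2<..}}"
    using \<phi> by (intro openin_continuous_map_preimage[OF continuous_map_product_projection]) auto
  moreover have "U = {L \<in> topspace (product_topology (\<lambda>_. euclideanreal) C0). L \<phi> \<in> {1/2<..}} \<inter> C0_dual"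
    by (auto simp: U_def C0_dual_def PiE_def)
  ultimately have "openin weak_star U"
    unfolding weak_star_def openin_subtopology by blast
  moreover have "C0_functional (distribution M d) \<in> U"
    using K fn[OF d, of K] d unfolding U_def \<phi>_def distribution_def
    by (auto intro!: C0_functional_in_dual prob_space_distr)
  ultimately have "weak_star_nbhd U (distribution M d)"
    unfolding weak_star_nbhd_def by (auto simp: U_def)
  from approx[OF this] obtain g where g: "integrable M g" "(\<integral>x. g x \<partial>M) = 0" "L1_norm M g = 1"
    and gU: "C0_functional (distribution M g) \<in> U" by blast
  have "1/2 < (\<integral>x. hat K (s * g x) \<partial>M)"
    using gU fn[OF g(1), of K] by (simp add: U_def \<phi>_def)
  also have "\<dots> \<le> (\<integral>x. (\<bar>g x\<bar> + s * g x) / 2 \<partial>M)"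
  proof (rule integral_mono)
    show "integrable M (\<lambda>x. hat K (s * g x))"
      using s g(1) by (intro Bochner_Integration.integrable_bound[OF integrable_abs[OF g(1)]])
        (auto simp: hat_def max_def min_def abs_if split: if_splits)
    show "hat K (s * g x) \<le> (\<bar>g x\<bar> + s * g x) / 2" for x
      using s by (auto simp: hat_def max_def min_def abs_if split: if_splits)
  qed (use g(1) in auto)
  also have "\<dots> = 1/2"
    using g by (simp add: L1_norm_def)
  finally show False by simp
qed

text \<open>
  The distribution of an integrable function of norm 1 can be approximated by the distributions of
  functions of norm 1 and integral 0 only if that function has integral 0 itself: mass can escape
  to infinity in the weak-star sense, but neither the positive nor the negative part of the limit
  can have integral above 1/2. The averages of a function with integral 0 have integral 0.
\<close>

lemma integral_zero_necessary:
  assumes M: "prob_space M" and d: "integrable M d" and n: "L1_norm M d = 1"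
    and approx: "\<And>U. weak_star_nbhd U (distribution M d) \<Longrightarrow>
      \<exists>g. integrable M g \<and> (\<integral>x. g x \<partial>M) = 0 \<and> L1_norm M g = 1 \<and>
          C0_functional (distribution M g) \<in> U"
  shows "(\<integral>x. d x \<partial>M) = 0"
proof -
  have eq: "(\<integral>x. max 0 (s * d x) \<partial>M) = (1 + s * (\<integral>x. d x \<partial>M)) / 2" if "\<bar>s\<bar> = 1" for s
  proof -
    have "(\<integral>x. max 0 (s * d x) \<partial>M) = (\<integral>x. (\<bar>d x\<bar> + s * d x) / 2 \<partial>M)"
      using that by (intro Bochner_Integration.integral_cong) (auto simp: abs_if max_def split: if_splits)
    then show ?thesis using d n by (simp add: L1_norm_def)
  qed
  have "(1 + s * (\<integral>x. d x \<partial>M)) / 2 \<le> 1/2" if "\<bar>s\<bar> = 1" for s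
    using pos_part_le_half[OF M d that approx] eq[OF that] by simp
  from this[of 1] this[of "-1"] show ?thesis by simp
qed

end

theory Submission
  imports Defs
begin

text \<open>
  The function is a series \<open>f = \<Sum>j. \<alpha> j * h j\<close> whose coefficients decrease so fast that at scale
  \<open>N j\<close> the later terms are negligible. The distribution of \<open>h j\<close> is close to that of \<open>d j\<close>, \<open>h j\<close>
  is almost invariant under the cube of side \<open>N j\<close>, and \<open>N j\<close> is chosen, before \<open>h j\<close>, so large
  that averaging over that cube kills the earlier terms. Hence the average of \<open>f\<close> at scale \<open>N j\<close> is
  \<open>\<alpha> j * h j\<close> up to a small relative error.

  To build \<open>h j\<close>, the distribution of \<open>d j\<close> is replaced by the uniform distribution on a finite
  list \<open>a 0, \<dots>, a (K - 1)\<close> with sum \<open>0\<close>. Over a base \<open>B\<close> whose translates by \<open>K\<close> disjoint large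
  cubes are disjoint, \<open>h j\<close> takes the value \<open>a r\<close> on the \<open>r\<close>-th cube of translates: the cubes being
  large makes it almost invariant, and the labels summing to \<open>0\<close> makes it a finite sum of
  coboundaries, whose averages tend to \<open>0\<close>. A maximal such \<open>B\<close> covers a fixed proportion of the
  space; repeating the construction in the complement of what is already covered, which is almost
  invariant at the new, smaller scale, exhausts the space up to arbitrarily small measure.
\<close>

section \<open>Measure-preserving actions and cubes\<close>

locale lattice_action = prob_space M for M :: "'a measure" +
  fixes T :: "int ^ 'd \<Rightarrow> 'a \<Rightarrow> 'a"
  assumes action: "zd_action M T"
begin

lemma T_measurable [measurable]: "T z \<in> M \<rightarrow>\<^sub>M M"
  using action by (simp add: zd_action_def)

lemma distr_T: "distr M M (T z) = M"
  using action by (simp add: zd_action_def)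

lemma T_space: "x \<in> space M \<Longrightarrow> T z x \<in> space M"
  using T_measurable by (rule measurable_space)

lemma T_zero: "x \<in> space M \<Longrightarrow> T 0 x = x"
  using action by (simp add: zd_action_def)

lemma T_add: "x \<in> space M \<Longrightarrow> T z (T w x) = T (z + w) x"
  using action by (simp add: zd_action_def)

lemma integrable_T: "integrable M g \<Longrightarrow> integrable M (\<lambda>x. g (T z x))" for g :: "'a \<Rightarrow> real"
  using integrable_distr[of "T z" M M g] by (simp add: distr_T)

lemma integral_T: "g \<in> borel_measurable M \<Longrightarrow> (\<integral>x. g (T z x) \<partial>M) = (\<integral>x. g x \<partial>M)" for g :: "'a \<Rightarrow> real"
  using integral_distr[of "T z" M M g] by (simp add: distr_T)

lemma L1_norm_T: "integrable M g \<Longrightarrow> L1_norm M (\<lambda>x. g (T z x)) = L1_norm M g"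
  unfolding L1_norm_def by (rule integral_T) auto

end

section \<open>Elementary estimates for the L1 norm\<close>

lemma L1_norm_cong: "(\<And>x. x \<in> space M \<Longrightarrow> f x = g x) \<Longrightarrow> L1_norm M f = L1_norm M g"
  unfolding L1_norm_def by (rule Bochner_Integration.integral_cong) auto

lemma L1_norm_nonneg: "0 \<le> L1_norm M g"
  unfolding L1_norm_def by simp

lemma L1_norm_scale: "L1_norm M (\<lambda>x. c * g x) = \<bar>c\<bar> * L1_norm M g"
  unfolding L1_norm_def by (simp add: abs_mult)

lemma L1_norm_mono:
  assumes "integrable M g" "integrable M h" "\<And>x. x \<in> space M \<Longrightarrow> \<bar>g x\<bar> \<le> \<bar>h x\<bar>"
  shows "L1_norm M g \<le> L1_norm M h"
  unfolding L1_norm_def using assms by (intro integral_mono) auto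

lemma L1_norm_add_le:
  assumes "integrable M g" "integrable M h"
  shows "L1_norm M (\<lambda>x. g x + h x) \<le> L1_norm M g + L1_norm M h"
proof -
  have "L1_norm M (\<lambda>x. g x + h x) \<le> (\<integral>x. \<bar>g x\<bar> + \<bar>h x\<bar> \<partial>M)"
    unfolding L1_norm_def using assms by (intro integral_mono) auto
  then show ?thesis using assms by (simp add: L1_norm_def)
qed

lemma L1_norm_diff_le:
  assumes "integrable M g" "integrable M h"
  shows "L1_norm M (\<lambda>x. g x - h x) \<le> L1_norm M g + L1_norm M h"
  using L1_norm_add_le[of M g "\<lambda>x. - h x"] assms by (simp add: L1_norm_def)

lemma L1_norm_sum_le:
  assumes "finite I" "\<And>i. i \<in> I \<Longrightarrow> integrable M (g i)"
  shows "L1_norm M (\<lambda>x. \<Sum>i\<in>I. g i x) \<le> (\<Sum>i\<in>I. L1_norm M (g i))"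
  using assms
proof (induction I)
  case (insert i I)
  then show ?case using L1_norm_add_le[of M "g i" "\<lambda>x. \<Sum>i\<in>I. g i x"] by simp
qed (simp add: L1_norm_def)

section \<open>Counting lattice points in boxes\<close>

lemma card_vec_Pi:
  fixes S :: "'n::finite \<Rightarrow> 'b set"
  shows "card {z :: 'b ^ 'n. \<forall>i. z $ i \<in> S i} = (\<Prod>i\<in>UNIV. card (S i))"
proof -
  have "bij_betw (\<lambda>f. \<chi> i. f i) (Pi\<^sub>E UNIV S) {z :: 'b ^ 'n. \<forall>i. z $ i \<in> S i}"
    by (rule bij_betwI[where g = "\<lambda>z i. z $ i"]) (auto simp: PiE_def Pi_def)
  from bij_betw_same_card[OF this] show ?thesis by (simp add: card_PiE)
qed

lemma finite_vec_Pi: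
  fixes S :: "'n::finite \<Rightarrow> 'b set"
  assumes "\<And>i. finite (S i)"
  shows "finite {z :: 'b ^ 'n. \<forall>i. z $ i \<in> S i}"
proof -
  have "{z :: 'b ^ 'n. \<forall>i. z $ i \<in> S i} \<subseteq> (\<lambda>f. \<chi> i. f i) ` (Pi\<^sub>E UNIV S)"
    by (intro subsetI, rule_tac x = "\<lambda>i. x $ i" in image_eqI) auto
  moreover have "finite (Pi\<^sub>E UNIV S)"
    by (rule finite_PiE) (simp_all add: assms)
  ultimately show ?thesis by (meson finite_imageI finite_subset)
qed

lemma cube_eq: "(cube N :: (int ^ 'd) set) = {z. \<forall>i. z $ i \<in> {1..int N}}"
  by (simp add: cube_def)

lemma finite_cube [simp]: "finite (cube N)"
  unfolding cube_eq using finite_vec_Pi[of "\<lambda>_. {1..int N}"] by simp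

lemma card_cube: "card (cube N :: (int ^ 'd) set) = N ^ CARD('d)"
  unfolding cube_eq card_vec_Pi by simp

text \<open>The symmetric difference of a cube and its translate by \<open>w\<close>, relative to
  the size of the cube. That it tends to 0 says that the cubes form a Folner sequence.\<close>

definition folner :: "int ^ 'd \<Rightarrow> nat \<Rightarrow> real" where
  "folner w N = real (card (cube N - (+) w ` cube N) + card ((+) w ` cube N - cube N)) / real N ^ CARD('d)"

text \<open>If \<open>q\<close> bounds the absolute value of every coordinate of \<open>w\<close>,
  the cube shrunk by \<open>q\<close> on every side lies both in the cube and in its translate. So
  the symmetric difference has at most 2 (N^d - (N - 2q)^d) points, which is of lower order than
  N^d.\<close>

lemma folner_tendsto_0: "folner (w :: int ^ 'd) \<longlonglongrightarrow> 0"
proof -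
  define q where "q = nat (\<Sum>i\<in>UNIV. \<bar>w $ i\<bar>)"
  have wq: "\<bar>w $ i\<bar> \<le> int q" for i
    using member_le_sum[of i UNIV "\<lambda>i. \<bar>w $ i\<bar>"] by (simp add: q_def)
  have bound: "folner w N \<le> 2 * (1 - (1 - 2 * real q / real N) ^ CARD('d))" if N: "N > 2 * q" for N
  proof -
    let ?I = "cube N \<inter> (+) w ` cube N"
    have "(+) (\<chi> i. int q) ` cube (N - 2 * q) \<subseteq> ?I"
    proof (intro subsetI IntI)
      fix z :: "int ^ 'd" assume "z \<in> (+) (\<chi> i. int q) ` cube (N - 2 * q)"
      then obtain y where y: "z = (\<chi> i. int q) + y" "\<And>i. 1 \<le> y $ i" "\<And>i. y $ i \<le> int N - 2 * int q"
        using N by (auto simp: cube_def of_nat_diff)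
      have "1 \<le> z $ i \<and> z $ i \<le> int N" "1 \<le> (z - w) $ i \<and> (z - w) $ i \<le> int N" for i
        using y(2)[of i] y(3)[of i] wq[of i] by (auto simp: y(1))
      then have zc: "z \<in> cube N" "z - w \<in> cube N"
        unfolding cube_def by blast+
      then show "z \<in> cube N" by blast
      from zc show "z \<in> (+) w ` cube N" by (intro image_eqI[of _ _ "z - w"]) auto
    qed
    then have "card ((+) (\<chi> i. int q) ` (cube (N - 2 * q) :: (int^'d) set)) \<le> card ?I"
      by (intro card_mono) auto
    then have I: "(N - 2 * q) ^ CARD('d) \<le> card ?I"
      by (simp add: card_image card_cube)
    have "card (cube N - (+) w ` cube N) + card ?I = card (cube N :: (int^'d) set)"
      by (subst card_Int_Diff[of _ "(+) w ` cube N"]) auto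
    moreover have "card ((+) w ` cube N - cube N) + card ?I = card ((+) w ` (cube N :: (int^'d) set))"
      by (subst card_Int_Diff[of _ "cube N"]) (auto simp: Int_commute)
    ultimately have "real (card (cube N - (+) w ` cube N) + card ((+) w ` cube N - cube N)) + 2 * real (card ?I)
        = 2 * real N ^ CARD('d)"
      by (simp add: card_image card_cube flip: of_nat_power)
    with I have "real (card (cube N - (+) w ` cube N) + card ((+) w ` cube N - cube N))
        \<le> 2 * real N ^ CARD('d) - 2 * real ((N - 2 * q) ^ CARD('d))"
      by linarith
    also have "\<dots> = 2 * (1 - (1 - 2 * real q / real N) ^ CARD('d)) * real N ^ CARD('d)"
      using N by (simp add: of_nat_diff algebra_simps flip: power_mult_distrib)
    finally show ?thesis
      unfolding folner_def using N by (subst pos_divide_le_eq) auto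
  qed
  have "(\<lambda>N. 2 * real q / real N) \<longlonglongrightarrow> 0"
    by (rule lim_const_over_n)
  then have "(\<lambda>N. 2 * (1 - (1 - 2 * real q / real N) ^ CARD('d))) \<longlonglongrightarrow> 2 * (1 - (1 - 0) ^ CARD('d))"
    by (intro tendsto_intros)
  then have lim: "(\<lambda>N. 2 * (1 - (1 - 2 * real q / real N) ^ CARD('d))) \<longlonglongrightarrow> 0" by simp
  show ?thesis
  proof (rule tendsto_sandwich[OF _ _ tendsto_const lim])
    show "\<forall>\<^sub>F N in sequentially. 0 \<le> folner w N" by (simp add: folner_def)
    show "\<forall>\<^sub>F N in sequentially. folner w N \<le> 2 * (1 - (1 - 2 * real q / real N) ^ CARD('d))"
      using eventually_gt_at_top[of "2 * q"] by eventually_elim (rule bound)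
  qed
qed

section \<open>Averages over cubes as operators on L1\<close>

context lattice_action
begin

lemma integrable_average: "integrable M g \<Longrightarrow> integrable M (average T N g)"
  unfolding average_def by (intro integrable_divide_zero Bochner_Integration.integrable_sum) (auto intro: integrable_T)

lemma L1_norm_average_le:
  assumes g: "integrable M g" and N: "N \<ge> 1"
  shows "L1_norm M (average T N g) \<le> L1_norm M g"
proof -
  have "L1_norm M (average T N g) = L1_norm M (\<lambda>x. \<Sum>z\<in>cube N. g (T z x)) / real N ^ CARD('d)"
    using L1_norm_scale[of M "1 / real N ^ CARD('d)" "\<lambda>x. \<Sum>z\<in>cube N. g (T z x)"]
    by (simp add: average_def[abs_def])
  also have "\<dots> \<le> (\<Sum>z\<in>(cube N :: (int ^ 'd) set). L1_norm M (\<lambda>x. g (T z x))) / real N ^ CARD('d)"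
    by (intro divide_right_mono L1_norm_sum_le) (auto intro: integrable_T g)
  also have "\<dots> = L1_norm M g"
    using N by (simp add: L1_norm_T[OF g] card_cube)
  finally show ?thesis .
qed

lemma average_add: "average T N (\<lambda>x. g x + h x) x = average T N g x + average T N h x"
  by (simp add: average_def sum.distrib add_divide_distrib)

lemma average_scale: "average T N (\<lambda>x. c * g x) x = c * average T N g x"
  by (simp add: average_def sum_distrib_left)

lemma average_sum: "average T N (\<lambda>x. \<Sum>i\<in>I. g i x) x = (\<Sum>i\<in>I. average T N (g i) x)"
  unfolding average_def by (subst sum.swap) (simp add: sum_divide_distrib)

text \<open>Composing \<open>g\<close> with \<open>T w\<close> replaces the cube by its translate.
  The terms common to both sums cancel, and each term left over has the norm of \<open>g\<close>
  because the action preserves the measure.\<close>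

lemma L1_norm_average_shift:
  assumes g: "integrable M g"
  shows "L1_norm M (\<lambda>x. average T N (\<lambda>x. g (T w x)) x - average T N g x) \<le> folner w N * L1_norm M g"
proof -
  let ?S = "cube N :: (int ^ 'd) set"
  let ?S' = "(+) w ` ?S"
  let ?c = "1 / real N ^ CARD('d)"
  let ?h = "\<lambda>A x. \<Sum>z\<in>A. g (T z x)"
  have eq: "average T N (\<lambda>x. g (T w x)) x - average T N g x = ?c * (?h (?S' - ?S) x - ?h (?S - ?S') x)"
    if "x \<in> space M" for x
  proof -
    have "(\<Sum>z\<in>?S. g (T w (T z x))) = ?h ?S' x"
      by (subst sum.reindex) (auto simp: T_add that)
    moreover have "?h ?S' x = ?h (?S' - ?S) x + ?h (?S' \<inter> ?S) x"
      by (subst sum.Int_Diff[of _ _ ?S]) auto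
    moreover have "?h ?S x = ?h (?S - ?S') x + ?h (?S' \<inter> ?S) x"
      by (subst sum.Int_Diff[of _ _ ?S']) (auto simp: Int_commute)
    ultimately show ?thesis by (simp add: average_def diff_divide_distrib add_divide_distrib)
  qed
  have int: "integrable M (?h A)" for A :: "(int ^ 'd) set"
    by (intro Bochner_Integration.integrable_sum integrable_T g)
  have norm: "L1_norm M (?h A) \<le> real (card A) * L1_norm M g" if "finite A" for A :: "(int ^ 'd) set"
    using L1_norm_sum_le[OF that, of M "\<lambda>z x. g (T z x)"] g by (simp add: integrable_T L1_norm_T)
  have "L1_norm M (\<lambda>x. average T N (\<lambda>x. g (T w x)) x - average T N g x)
      = ?c * L1_norm M (\<lambda>x. ?h (?S' - ?S) x - ?h (?S - ?S') x)"
    using L1_norm_scale[of M ?c] by (subst L1_norm_cong[OF eq]) auto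
  also have "\<dots> \<le> ?c * (L1_norm M (?h (?S' - ?S)) + L1_norm M (?h (?S - ?S')))"
    by (intro mult_left_mono L1_norm_diff_le int) auto
  also have "\<dots> \<le> ?c * (real (card (?S' - ?S)) * L1_norm M g + real (card (?S - ?S')) * L1_norm M g)"
    by (intro mult_left_mono add_mono norm) auto
  also have "\<dots> = folner w N * L1_norm M g"
    by (simp add: folner_def field_simps)
  finally show ?thesis .
qed

end

section \<open>Maximal independent sets\<close>

text \<open>The isomorphism with a Borel measure on the line is an injective real function, but it
  is measurable only for the completion and defined only on \<open>X0\<close>. An
  \<open>M\<close>-measurable function that agrees with it almost everywhere is still injective off
  a null set.\<close>

lemma lebesgue_prob_space_separating:
  assumes "lebesgue_prob_space M"
  shows "\<exists>U \<in> borel_measurable M. \<exists>X \<in> sets M. emeasure M (space M - X) = 0 \<and> inj_on (U :: 'a \<Rightarrow> real) X"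
proof -
  from assms obtain \<nu> :: "real measure" and X0 Y0 h where
    \<nu>: "sets \<nu> = sets borel" and X0: "X0 \<in> sets (completion M)"
    and null: "emeasure (completion M) (space M - X0) = 0"
    and bij: "bij_betw h X0 Y0"
    and h: "h \<in> restrict_space (completion M) X0 \<rightarrow>\<^sub>M restrict_space (completion \<nu>) Y0"
    unfolding lebesgue_prob_space_def iso_mod0_def by auto
  have "h \<in> restrict_space (completion M) X0 \<rightarrow>\<^sub>M completion \<nu>"
    using h by (simp add: measurable_restrict_space2_iff)
  then have "h \<in> borel_measurable (restrict_space (completion M) X0)"
    by (rule measurable_mono[of borel "completion \<nu>", THEN subsetD, rotated -1])
      (use \<nu> sets_eq_imp_space_eq[OF \<nu>] in auto)
  \<comment> \<open>Extension by 0 gives a function on the whole space, as needed to pass from the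
    completion to \<open>M\<close>.\<close>
  then have "(\<lambda>x. indicator X0 x *\<^sub>R h x) \<in> borel_measurable (completion M)"
    using X0 by (subst (asm) borel_measurable_restrict_space_iff) auto
  from completion_ex_borel_measurable_real[OF this] obtain U where
    U: "U \<in> borel_measurable M" "AE x in M. indicator X0 x *\<^sub>R h x = U x" by blast
  have "AE x in completion M. x \<in> X0"
    using X0 null by (intro AE_I[of _ _ "space M - X0"]) auto
  then have "AE x in M. x \<in> X0" by (simp add: AE_completion_iff)
  with U(2) have "AE x in M. x \<in> X0 \<and> h x = U x" by eventually_elim auto
  then obtain N where N: "{x \<in> space M. \<not> (x \<in> X0 \<and> h x = U x)} \<subseteq> N" "emeasure M N = 0" "N \<in> sets M"
    by (rule AE_E)
  have "inj_on U (space M - N)"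
  proof (rule inj_onI)
    fix x y assume *: "x \<in> space M - N" "y \<in> space M - N" "U x = U y"
    then have "x \<in> X0" "y \<in> X0" "h x = U x" "h y = U y" using N(1) by auto
    with *(3) have "x \<in> X0" "y \<in> X0" "h x = h y" by auto
    then show "x = y" using bij by (auto simp: bij_betw_def inj_on_def)
  qed
  moreover have "space M - (space M - N) = N" using N(3) sets.sets_into_space by blast
  ultimately show ?thesis
    using U(1) N by (intro bexI[of _ U] bexI[of _ "space M - N"]) auto
qed

context lattice_action
begin

text \<open>The lattice is countable and the action preserves the measure, so almost every orbit
  stays inside the set on which \<open>U\<close> is injective. On such an orbit freeness turns
  distinct points into distinct values.\<close>

lemma separating_function:
  assumes "lebesgue_prob_space M" "free_action M T"
  shows "\<exists>U \<in> borel_measurable M. \<exists>X \<in> sets M. measure M X = 1 \<and>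
    (\<forall>x\<in>X. \<forall>w. w \<noteq> 0 \<longrightarrow> (U :: 'a \<Rightarrow> real) (T w x) \<noteq> U x)"
proof -
  from lebesgue_prob_space_separating[OF assms(1)] obtain U X1 where
    U: "U \<in> borel_measurable M" and X1: "X1 \<in> sets M" "emeasure M (space M - X1) = 0"
    and inj: "inj_on (U :: 'a \<Rightarrow> real) X1" by blast
  have "AE x in M. x \<in> X1"
    using X1 by (intro AE_I[of _ _ "space M - X1"]) auto
  then have "AE x in distr M M (T z). x \<in> X1" for z unfolding distr_T .
  then have "AE x in M. T z x \<in> X1" for z using X1(1) by (subst (asm) AE_distr_iff) auto
  then have "AE x in M. \<forall>z. T z x \<in> X1" by (simp add: AE_all_countable)
  moreover have "AE x in M. \<forall>z. z \<noteq> 0 \<longrightarrow> T z x \<noteq> x"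
    using assms(2) by (simp add: free_action_def)
  ultimately have "AE x in M. (\<forall>z. T z x \<in> X1) \<and> (\<forall>z. z \<noteq> 0 \<longrightarrow> T z x \<noteq> x)" by eventually_elim auto
  then obtain N where N: "{x \<in> space M. \<not> ((\<forall>z. T z x \<in> X1) \<and> (\<forall>z. z \<noteq> 0 \<longrightarrow> T z x \<noteq> x))} \<subseteq> N"
      "emeasure M N = 0" "N \<in> sets M"
    by (rule AE_E)
  have "U (T w x) \<noteq> U x" if "x \<in> space M - N" "w \<noteq> 0" for x w
  proof
    assume eq: "U (T w x) = U x"
    have x: "\<forall>z. T z x \<in> X1" "T w x \<noteq> x" "x \<in> space M" using that N(1) by auto
    then have "x \<in> X1" using T_zero by metis
    with x eq inj show False by (auto simp: inj_on_def)
  qed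
  moreover have "measure M (space M - N) = 1"
    using N by (subst prob_compl) (auto simp: measure_def)
  ultimately show ?thesis using U N(3) by (intro bexI[of _ U] bexI[of _ "space M - N"]) auto
qed

text \<open>
  A measurable maximal independent set of the graph that joins \<open>x\<close> to \<open>T w x\<close> for \<open>w \<in> D\<close>. It is
  built greedily along a countable cover of \<open>C\<close> by independent sets, obtained by asking that a
  rational interval separates the value of \<open>U\<close> at a point from its values at the neighbours.
\<close>

lemma maximal_independent_set:
  fixes U :: "'a \<Rightarrow> real" and D :: "(int ^ 'd) set"
  assumes U [measurable]: "U \<in> borel_measurable M" and C [measurable]: "C \<in> sets M"
    and D: "finite D" "\<And>w. w \<in> D \<Longrightarrow> - w \<in> D"
    and sep: "\<And>x w. x \<in> C \<Longrightarrow> w \<in> D \<Longrightarrow> U (T w x) \<noteq> U x"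
  obtains B where "B \<in> sets M" "B \<subseteq> C" "\<And>x w. x \<in> B \<Longrightarrow> w \<in> D \<Longrightarrow> T w x \<notin> B"
    "\<And>x. x \<in> C \<Longrightarrow> x \<in> B \<or> (\<exists>w\<in>D. T w x \<in> B)"
proof -
  define I :: "nat \<Rightarrow> real set" where
    "I n = (let (a, b) = from_nat n :: rat \<times> rat in {of_rat a<..<of_rat b})" for n
  have I [measurable]: "I n \<in> sets borel" for n by (simp add: I_def split: prod.split)
  \<comment> \<open>Neighbours never lie in the same \<open>A n\<close>: the interval
    \<open>I n\<close> contains the value of \<open>U\<close> at a point of \<open>A n\<close> and
    none of the values at its neighbours.\<close>
  define A where "A n = {x \<in> space M. x \<in> C \<and> U x \<in> I n \<and> (\<forall>w\<in>D. U (T w x) \<notin> I n)}" for n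
  have A [measurable]: "A n \<in> sets M" for n
    unfolding A_def using D(1) by measurable
  define B where "B = rec_nat {} (\<lambda>n b. b \<union> {x \<in> space M. x \<in> A n \<and> (\<forall>w\<in>D. T w x \<notin> b)})"
  have B_0: "B 0 = {}" and B_Suc: "B (Suc n) = B n \<union> {x \<in> space M. x \<in> A n \<and> (\<forall>w\<in>D. T w x \<notin> B n)}" for n
    by (simp_all add: B_def)
  have B_sets [measurable]: "B n \<in> sets M" for n
  proof (induction n)
    case (Suc n)
    note [measurable] = Suc
    show ?case unfolding B_Suc using D(1) by measurable
  qed (simp add: B_0)
  have B_C: "B n \<subseteq> C" for n
    by (induction n) (auto simp: B_0 B_Suc A_def)
  have C_space: "x \<in> C \<Longrightarrow> x \<in> space M" for x using C sets.sets_into_space by blast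
  have indep: "T w x \<notin> B n" if "x \<in> B n" "w \<in> D" for x w n
    using that
  proof (induction n arbitrary: x w)
    case (Suc n)
    have x: "x \<in> space M" using Suc.prems(1) B_C C_space by blast
    have inv: "T (- w) (T w x) = x" using x by (simp add: T_add T_zero)
    show ?case
    proof
      assume "T w x \<in> B (Suc n)"
      then consider "T w x \<in> B n" | "T w x \<in> A n" "\<forall>v\<in>D. T v (T w x) \<notin> B n" by (auto simp: B_Suc)
      then show False
      proof cases
        case 1
        with Suc show False by (auto simp: B_Suc)
      next
        case 2
        \<comment> \<open>Symmetry of \<open>D\<close> allows the step back along
          \<open>- w\<close>: \<open>T w x\<close> was added only because its neighbours,
          \<open>x\<close> among them, were absent. So \<open>x\<close> was added at the same stage,
          and both points lie in \<open>A n\<close>.\<close>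
        then have "x \<notin> B n" using D(2)[OF Suc.prems(2)] inv by metis
        with Suc.prems(1) have "x \<in> A n" by (auto simp: B_Suc)
        with 2(1) Suc.prems(2) show False by (auto simp: A_def)
      qed
    qed
  qed (simp add: B_0)
  have mono: "B m \<subseteq> B n" if "m \<le> n" for m n
    using that by (rule lift_Suc_mono_le[of B, rotated]) (auto simp: B_Suc)
  show thesis
  proof
    show "(\<Union>n. B n) \<in> sets M" by measurable
    show "(\<Union>n. B n) \<subseteq> C" using B_C by blast
    show "T w x \<notin> (\<Union>n. B n)" if x: "x \<in> (\<Union>n. B n)" and w: "w \<in> D" for x w
    proof
      assume "T w x \<in> (\<Union>n. B n)"
      with x obtain m n where "x \<in> B m" "T w x \<in> B n" by blast
      then have "x \<in> B (max m n)" "T w x \<in> B (max m n)"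
        using mono[of m "max m n"] mono[of n "max m n"] by auto
      with indep w show False by blast
    qed
    show "x \<in> (\<Union>n. B n) \<or> (\<exists>w\<in>D. T w x \<in> (\<Union>n. B n))" if x: "x \<in> C" for x
    proof -
      \<comment> \<open>The finitely many values at the neighbours stay at a positive distance from
        \<open>U x\<close>, so a rational interval isolates \<open>U x\<close> from them.\<close>
      have "open (- (\<lambda>w. U (T w x)) ` D)"
        using D(1) by (intro open_Compl finite_imp_closed) auto
      moreover have "U x \<in> - (\<lambda>w. U (T w x)) ` D" using sep[OF x] by force
      ultimately obtain e where e: "e > 0" "ball (U x) e \<subseteq> - (\<lambda>w. U (T w x)) ` D"
        by (meson open_contains_ball)
      obtain a b where a: "U x - e < of_rat a" "of_rat a < U x" and b: "U x < of_rat b" "of_rat b < U x + e"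
        using of_rat_dense[of "U x - e" "U x"] of_rat_dense[of "U x" "U x + e"] e(1) by auto
      define n where "n = to_nat (a, b)"
      have In: "I n = {of_rat a<..<of_rat b}" by (simp add: I_def n_def)
      have "I n \<subseteq> ball (U x) e" using a b by (auto simp: In dist_real_def)
      with e(2) have "\<forall>w\<in>D. U (T w x) \<notin> I n" by blast
      moreover have "U x \<in> I n" using a b by (simp add: In)
      ultimately have "x \<in> A n" using x C_space by (simp add: A_def)
      then have "x \<in> B (Suc n) \<or> (\<exists>w\<in>D. T w x \<in> B n)" using C_space x by (auto simp: B_Suc)
      then show ?thesis by blast
    qed
  qed
qed

end

section \<open>Stacks of cubes\<close>

text \<open>\<^term>\<open>offset L\<close> maps \<^term>\<open>labels K L\<close> to \<open>K\<close> disjoint cubes of side \<open>L\<close> placed along the diagonal.\<close>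

definition offset :: "nat \<Rightarrow> nat \<times> (int ^ 'd) \<Rightarrow> int ^ 'd" where
  "offset L j = snd j + (\<chi> i. int (fst j * L))"

definition labels :: "nat \<Rightarrow> nat \<Rightarrow> (nat \<times> (int ^ 'd)) set" where
  "labels K L = {..<K} \<times> cube L"

lemma finite_labels [simp]: "finite (labels K L)"
  by (simp add: labels_def)

text \<open>In any one coordinate the cube with index \<open>r\<close> occupies the integers from rL
  + 1 to (r + 1)L. These intervals are disjoint, so a single coordinate already determines the
  index.\<close>

lemma inj_on_offset: "inj_on (offset L) (labels K L :: (nat \<times> (int ^ 'd)) set)"
proof (rule inj_onI)
  fix j k :: "nat \<times> (int ^ 'd)"
  assume j: "j \<in> labels K L" and k: "k \<in> labels K L" and eq: "offset L j = offset L k"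
  obtain r z s y where [simp]: "j = (r, z)" "k = (s, y)" by fastforce
  fix i0 :: 'd
  have e: "z $ i + int r * int L = y $ i + int s * int L" for i
    using arg_cong[OF eq, of "\<lambda>v. v $ i"] by (simp add: offset_def)
  have b: "1 \<le> z $ i" "z $ i \<le> int L" "1 \<le> y $ i" "y $ i \<le> int L" for i
    using j k by (auto simp: labels_def cube_def)
  have "\<not> r < s" "\<not> s < r"
  proof -
    have less: False if "r' < s'" "z' + int r' * int L = y' + int s' * int L" "z' \<le> int L" "1 \<le> y'" for r' s' z' y'
    proof -
      have "(int r' + 1) * int L \<le> int s' * int L" using that(1) by (intro mult_right_mono) auto
      with that(2-) show False by (simp add: algebra_simps)
    qed
    show "\<not> r < s" using less[OF _ e[of i0]] b by blast
    show "\<not> s < r" using less[OF _ e[of i0, symmetric]] b by blast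
  qed
  then have "r = s" by simp
  with e have "z = y" by (simp add: vec_eq_iff)
  with \<open>r = s\<close> show "j = k" by simp
qed

lemma sum_labels: "(\<Sum>j\<in>(labels K L :: (nat \<times> (int ^ 'd)) set). f (fst j)) = real L ^ CARD('d) * (\<Sum>r<K. f r)"
proof -
  have "(\<Sum>j\<in>(labels K L :: (nat \<times> (int ^ 'd)) set). f (fst j)) = (\<Sum>r<K. \<Sum>z\<in>(cube L :: (int ^ 'd) set). f r)"
    unfolding labels_def by (subst sum.cartesian_product) (simp add: case_prod_beta)
  then show ?thesis by (simp add: card_cube sum_distrib_left)
qed

text \<open>If two labels carry the same point into \<open>B\<close>, the two images differ by one
  of these vectors. Avoiding the nonzero ones is what makes the translates of \<open>B\<close>
  disjoint.\<close>

definition offset_differences :: "nat \<Rightarrow> nat \<Rightarrow> (int ^ 'd) set" where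
  "offset_differences K L = (\<lambda>(j, k). offset L j - offset L k) ` (labels K L \<times> labels K L)"

lemma finite_offset_differences [simp]: "finite (offset_differences K L)"
  by (simp add: offset_differences_def)

text \<open>Differences of cube points lie in a box with (2L)^d points, and differences of cube
  positions take at most \<open>K * K\<close> values. The bound exceeds the number K L^d of labels
  only by a factor independent of \<open>L\<close>, so enlarging the cubes does not spoil the
  proportion that gets covered.\<close>

lemma card_offset_differences:
  "card (offset_differences K L :: (int ^ 'd) set) \<le> K * K * (2 * L) ^ CARD('d)"
proof -
  define Box where "Box = {z :: int ^ 'd. \<forall>i. z $ i \<in> {- int L<..int L}}"
  have Box: "finite Box" "card Box = (2 * L) ^ CARD('d)"
    using finite_vec_Pi[of "\<lambda>_. {- int L<..int L}"] card_vec_Pi[of "\<lambda>_ :: 'd. {- int L<..int L}"]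
    unfolding Box_def by (simp_all add: nat_mult_distrib)
  define V :: "nat \<times> nat \<Rightarrow> int ^ 'd" where "V rs = (\<chi> i. int (fst rs * L)) - (\<chi> i. int (snd rs * L))" for rs
  have "offset_differences K L \<subseteq> (\<lambda>(rs, y). y + V rs) ` (({..<K} \<times> {..<K}) \<times> Box)"
  proof (clarsimp simp: offset_differences_def)
    fix r s and z y :: "int ^ 'd"
    assume j: "(r, z) \<in> labels K L" and k: "(s, y) \<in> labels K L"
    have "- int L < z $ i - y $ i \<and> z $ i - y $ i \<le> int L" for i
    proof -
      have "1 \<le> z $ i" "z $ i \<le> int L" "1 \<le> y $ i" "y $ i \<le> int L"
        using j k by (simp_all add: labels_def cube_def)
      then show ?thesis by linarith
    qed
    then have "z - y \<in> Box" by (simp add: Box_def)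
    moreover have "offset L (r, z) - offset L (s, y) = (z - y) + V (r, s)" by (simp add: offset_def V_def)
    moreover have "r < K" "s < K" using j k by (auto simp: labels_def)
    ultimately show "offset L (r, z) - offset L (s, y) \<in> (\<lambda>(rs, y). y + V rs) ` (({..<K} \<times> {..<K}) \<times> Box)"
      by (intro image_eqI[of _ _ "((r, s), z - y)"]) auto
  qed
  then have "card (offset_differences K L :: (int ^ 'd) set) \<le> card ((\<lambda>(rs, y). y + V rs) ` (({..<K} \<times> {..<K}) \<times> Box))"
    by (intro card_mono) (auto simp: Box(1))
  also have "\<dots> \<le> card (({..<K} \<times> {..<K}) \<times> Box)"
    by (intro card_image_le) (auto simp: Box(1))
  finally show ?thesis by (simp add: card_cartesian_product Box(2))
qed

section \<open>Functions with prescribed values on stacked translates of a base\<close>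

context lattice_action
begin

definition stack :: "nat \<Rightarrow> (nat \<Rightarrow> real) \<Rightarrow> nat \<Rightarrow> 'a set \<Rightarrow> 'a \<Rightarrow> real" where
  "stack K a L B x = (\<Sum>j\<in>labels K L. a (fst j) * indicator B (T (offset L j) x))"

lemma integrable_indicator_set: "B \<in> sets M \<Longrightarrow> integrable M (indicator B :: 'a \<Rightarrow> real)"
  by (simp add: less_top[symmetric])

lemma L1_norm_indicator: "B \<in> sets M \<Longrightarrow> L1_norm M (indicator B) = measure M B"
  by (simp add: L1_norm_def)

lemma integrable_stack:
  assumes "B \<in> sets M"
  shows "integrable M (stack K a L B)"
  unfolding stack_def[abs_def] using assms
  by (intro Bochner_Integration.integrable_sum integrable_mult_right integrable_T integrable_indicator_set)

lemma integral_stack: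
  assumes "B \<in> sets M"
  shows "(\<integral>x. stack K a L B x \<partial>M) = real L ^ CARD('d) * measure M B * (\<Sum>r<K. a r)"
proof -
  have i: "integrable M (\<lambda>x. indicator B (T w x) :: real)" for w
    using assms by (intro integrable_T integrable_indicator_set)
  have e: "(\<integral>x. (indicator B (T w x) :: real) \<partial>M) = measure M B" for w
    using integral_T[of "indicator B" w] assms by simp
  have "(\<integral>x. stack K a L B x \<partial>M) = (\<Sum>j\<in>(labels K L :: (nat \<times> (int ^ 'd)) set). a (fst j) * measure M B)"
    unfolding stack_def using i e by (subst Bochner_Integration.integral_sum) auto
  also have "\<dots> = real L ^ CARD('d) * (\<Sum>r<K. a r * measure M B)"
    by (rule sum_labels)
  finally show ?thesis by (simp add: sum_distrib_left sum_distrib_right ac_simps)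
qed

text \<open>The averages commute with the action because the lattice is commutative.\<close>

lemma average_T:
  assumes "x \<in> space M"
  shows "average T N g (T w x) = average T N (\<lambda>x. g (T w x)) x"
  using assms by (simp add: average_def T_add add.commute)

text \<open>On each of the \<open>K\<close> cubes the stack is a multiple of an average over the
  cube of side \<open>L\<close>, so the shift estimate for averages applies cube by cube.\<close>

lemma L1_norm_stack_shift:
  assumes B: "B \<in> sets M" and L: "L \<ge> 1"
  shows "L1_norm M (\<lambda>x. stack K a L B (T w x) - stack K a L B x)
    \<le> (\<Sum>r<K. \<bar>a r\<bar>) * folner w L * (real L ^ CARD('d) * measure M B)"
proof -
  define v :: "nat \<Rightarrow> int ^ 'd" where "v r = (\<chi> i. int (r * L))" for r
  define g :: "nat \<Rightarrow> 'a \<Rightarrow> real" where "g r x = indicator B (T (v r) x)" for r x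
  have g: "integrable M (g r)" for r
    unfolding g_def[abs_def] by (intro integrable_T integrable_indicator_set B)
  have g_norm: "L1_norm M (g r) = measure M B" for r
    unfolding g_def[abs_def] using L1_norm_T[OF integrable_indicator_set[OF B]] by (simp add: L1_norm_indicator B)
  let ?c = "real L ^ CARD('d)"
  have stack: "stack K a L B x = (\<Sum>r<K. a r * ?c * average T L (g r) x)" if x: "x \<in> space M" for x
  proof -
    have "stack K a L B x = (\<Sum>r<K. \<Sum>z\<in>(cube L :: (int ^ 'd) set). a r * indicator B (T (z + v r) x))"
      unfolding stack_def labels_def by (subst sum.cartesian_product) (simp add: case_prod_beta offset_def v_def)
    also have "\<dots> = (\<Sum>r<K. a r * ?c * average T L (g r) x)"
      using L x by (intro sum.cong refl) (simp add: average_def g_def T_add add.commute sum_distrib_left)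
    finally show ?thesis .
  qed
  let ?\<Delta> = "\<lambda>r x. average T L (\<lambda>x. g r (T w x)) x - average T L (g r) x"
  have \<Delta>: "integrable M (?\<Delta> r)" for r
    by (intro Bochner_Integration.integrable_diff integrable_average integrable_T g)
  have "L1_norm M (\<lambda>x. stack K a L B (T w x) - stack K a L B x) = L1_norm M (\<lambda>x. \<Sum>r<K. a r * ?c * ?\<Delta> r x)"
    by (rule L1_norm_cong)
      (simp add: stack T_space average_T algebra_simps flip: sum_subtractf)
  also have "\<dots> \<le> (\<Sum>r<K. L1_norm M (\<lambda>x. a r * ?c * ?\<Delta> r x))"
    by (intro L1_norm_sum_le integrable_mult_right \<Delta>) auto
  also have "\<dots> = (\<Sum>r<K. \<bar>a r\<bar> * ?c * L1_norm M (?\<Delta> r))"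
    by (simp add: L1_norm_scale abs_mult)
  also have "\<dots> \<le> (\<Sum>r<K. \<bar>a r\<bar> * ?c * (folner w L * measure M B))"
    using L1_norm_average_shift[OF g] g_norm by (intro sum_mono mult_left_mono) auto
  finally show ?thesis by (simp add: sum_distrib_left sum_distrib_right ac_simps)
qed

text \<open>If the labels sum to \<open>0\<close>, a stack is a finite sum of coboundaries.\<close>

lemma L1_norm_average_stack_tendsto_0:
  assumes B: "B \<in> sets M" and a: "(\<Sum>r<K. a r) = 0"
  shows "(\<lambda>N. L1_norm M (average T N (stack K a L B))) \<longlonglongrightarrow> 0"
proof -
  let ?J = "labels K L :: (nat \<times> (int ^ 'd)) set"
  let ?b = "indicator B :: 'a \<Rightarrow> real"
  let ?\<Delta> = "\<lambda>N j x. average T N (\<lambda>x. ?b (T (offset L j) x)) x - average T N ?b x"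
  have b: "integrable M ?b" by (rule integrable_indicator_set[OF B])
  have \<Delta>: "integrable M (?\<Delta> N j)" for N j
    by (intro Bochner_Integration.integrable_diff integrable_average integrable_T b)
  have zero: "(\<Sum>j\<in>?J. a (fst j)) = 0" using sum_labels[of a, where 'd = 'd] a by simp
  have "average T N (stack K a L B) x = (\<Sum>j\<in>?J. a (fst j) * ?\<Delta> N j x)" for N x
  proof -
    have "average T N (stack K a L B) x = (\<Sum>j\<in>?J. a (fst j) * average T N (\<lambda>x. ?b (T (offset L j) x)) x)"
      unfolding stack_def[abs_def] average_sum average_scale ..
    \<comment> \<open>The same average of the unshifted indicator is subtracted from every term. Its
      total coefficient is 0, so only differences controlled by \<open>folner\<close>
      remain.\<close>
    also have "\<dots> = (\<Sum>j\<in>?J. a (fst j) * ?\<Delta> N j x) + (\<Sum>j\<in>?J. a (fst j)) * average T N ?b x"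
      by (simp add: right_diff_distrib sum_subtractf sum_distrib_right)
    finally show ?thesis by (simp add: zero)
  qed
  then have "L1_norm M (average T N (stack K a L B)) = L1_norm M (\<lambda>x. \<Sum>j\<in>?J. a (fst j) * ?\<Delta> N j x)" for N
    by (intro L1_norm_cong) simp
  also have "\<dots> N \<le> (\<Sum>j\<in>?J. \<bar>a (fst j)\<bar> * L1_norm M (?\<Delta> N j))" for N
    using L1_norm_sum_le[of ?J M "\<lambda>j x. a (fst j) * ?\<Delta> N j x"] \<Delta> by (simp add: L1_norm_scale)
  also have "\<dots> N \<le> (\<Sum>j\<in>?J. \<bar>a (fst j)\<bar> * (folner (offset L j) N * L1_norm M ?b))" for N
    by (intro sum_mono mult_left_mono L1_norm_average_shift b) auto
  finally have le: "L1_norm M (average T N (stack K a L B))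
      \<le> (\<Sum>j\<in>?J. \<bar>a (fst j)\<bar> * (folner (offset L j) N * L1_norm M ?b))" for N .
  have "(\<lambda>N. \<Sum>j\<in>?J. \<bar>a (fst j)\<bar> * (folner (offset L j) N * L1_norm M ?b))
      \<longlonglongrightarrow> (\<Sum>j\<in>?J. \<bar>a (fst j)\<bar> * (0 * L1_norm M ?b))"
    by (intro tendsto_intros folner_tendsto_0)
  then have lim: "(\<lambda>N. \<Sum>j\<in>?J. \<bar>a (fst j)\<bar> * (folner (offset L j) N * L1_norm M ?b)) \<longlonglongrightarrow> 0" by simp
  show ?thesis
    by (rule tendsto_sandwich[OF _ _ tendsto_const lim]) (simp_all add: L1_norm_nonneg le)
qed

text \<open>At most one summand is nonzero at \<open>x\<close>, so \<phi> acts on that summand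
  alone; where no summand survives, \<open>\<phi> 0 = 0\<close> gives equality.\<close>

lemma stack_compose:
  assumes disj: "\<And>j k. j \<in> labels K L \<Longrightarrow> k \<in> labels K L \<Longrightarrow>
      T (offset L j) x \<in> B \<Longrightarrow> T (offset L k) x \<in> B \<Longrightarrow> j = k"
    and "\<phi> 0 = 0"
  shows "\<phi> (stack K a L B x) = stack K (\<lambda>r. \<phi> (a r)) L B x"
proof (cases "\<exists>j\<in>labels K L. T (offset L j) x \<in> B")
  case True
  then obtain j where j: "j \<in> labels K L" "T (offset L j) x \<in> B" by blast
  have "T (offset L k) x \<in> B \<longleftrightarrow> k = j" if "k \<in> labels K L" for k
    using j disj[OF j(1) that j(2)] by blast
  then have "stack K b L B x = (\<Sum>k\<in>labels K L. if k = j then b (fst j) else 0)" for b :: "nat \<Rightarrow> real"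
    unfolding stack_def by (intro sum.cong refl) (simp add: indicator_def)
  then have "stack K b L B x = b (fst j)" for b :: "nat \<Rightarrow> real" using j by simp
  then show ?thesis by simp
next
  case False
  then have "stack K b L B x = 0" for b :: "nat \<Rightarrow> real" by (auto simp: stack_def)
  then show ?thesis by (simp add: assms(2))
qed

end

section \<open>Exhaustion of the space\<close>

context lattice_action
begin

text \<open>
  \<open>h\<close> vanishes off \<open>E\<close>, and under the normalized measure on \<open>E\<close> it is uniformly distributed on
  \<open>a 0, \<dots>, a (K - 1)\<close>. The condition \<open>\<phi> 0 = 0\<close> makes the integrals additive over disjoint pieces.
\<close>

definition partial_copy ::
    "nat \<Rightarrow> (nat \<Rightarrow> real) \<Rightarrow> (int ^ 'd) set \<Rightarrow> real \<Rightarrow> 'a set \<Rightarrow> ('a \<Rightarrow> real) \<Rightarrow> bool" where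
  "partial_copy K a F \<epsilon> E h \<longleftrightarrow>
     E \<in> sets M \<and> h \<in> borel_measurable M \<and> (\<forall>x\<in>space M - E. h x = 0) \<and>
     (\<forall>\<phi>\<in>borel_measurable borel. \<phi> 0 = (0 :: real) \<longrightarrow>
        integrable M (\<lambda>x. \<phi> (h x)) \<and> (\<integral>x. \<phi> (h x) \<partial>M) = measure M E * ((\<Sum>r<K. \<phi> (a r)) / real K)) \<and>
     (\<forall>w\<in>F. L1_norm M (\<lambda>x. indicator E (T w x) - indicator E x) \<le> \<epsilon> \<and>
        L1_norm M (\<lambda>x. h (T w x) - h x) \<le> \<epsilon>) \<and>
     (\<lambda>N. L1_norm M (average T N h)) \<longlonglongrightarrow> 0"

lemma partial_copyD:
  assumes "partial_copy K a F \<epsilon> E h"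
  shows "E \<in> sets M" "h \<in> borel_measurable M" "\<And>x. x \<in> space M \<Longrightarrow> x \<notin> E \<Longrightarrow> h x = 0"
    "\<And>\<phi>. \<phi> \<in> borel_measurable borel \<Longrightarrow> \<phi> 0 = (0 :: real) \<Longrightarrow> integrable M (\<lambda>x. \<phi> (h x))"
    "\<And>\<phi>. \<phi> \<in> borel_measurable borel \<Longrightarrow> \<phi> 0 = (0 :: real) \<Longrightarrow>
      (\<integral>x. \<phi> (h x) \<partial>M) = measure M E * ((\<Sum>r<K. \<phi> (a r)) / real K)"
    "\<And>w. w \<in> F \<Longrightarrow> L1_norm M (\<lambda>x. indicator E (T w x) - indicator E x) \<le> \<epsilon>"
    "\<And>w. w \<in> F \<Longrightarrow> L1_norm M (\<lambda>x. h (T w x) - h x) \<le> \<epsilon>"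
    "(\<lambda>N. L1_norm M (average T N h)) \<longlonglongrightarrow> 0"
  using assms unfolding partial_copy_def by auto

lemma partial_copy_integrable: "partial_copy K a F \<epsilon> E h \<Longrightarrow> integrable M h"
  using partial_copyD(4)[of K a F \<epsilon> E h "\<lambda>t. t"] by simp

lemma partial_copy_empty:
  assumes "\<epsilon> \<ge> 0"
  shows "partial_copy K a F \<epsilon> {} (\<lambda>_. 0)"
  using assms unfolding partial_copy_def by (simp add: L1_norm_def average_def)

lemma partial_copy_mono:
  assumes "partial_copy K a F \<epsilon> E h" "F' \<subseteq> F" "\<epsilon> \<le> \<epsilon>'"
  shows "partial_copy K a F' \<epsilon>' E h"
  using assms unfolding partial_copy_def by (meson order_trans subsetD)

text \<open>At every point at least one of \<open>h\<close>, \<open>h'\<close> vanishes, so \<phi>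
  with \<open>\<phi> 0 = 0\<close> is additive on their sum. Invariance errors add by the triangle
  inequality.\<close>

lemma partial_copy_Un:
  assumes 1: "partial_copy K a F \<epsilon> E h" and 2: "partial_copy K a F \<delta> E' h'" and disj: "E \<inter> E' = {}"
  shows "partial_copy K a F (\<epsilon> + \<delta>) (E \<union> E') (\<lambda>x. h x + h' x)"
  unfolding partial_copy_def
proof (intro conjI ballI impI)
  note [measurable] = partial_copyD(1,2)[OF 1] partial_copyD(1,2)[OF 2]
  have h: "integrable M h" "integrable M h'" using 1 2 by (auto intro: partial_copy_integrable)
  show "E \<union> E' \<in> events" "(\<lambda>x. h x + h' x) \<in> borel_measurable M" by measurable
  show "h x + h' x = 0" if "x \<in> space M - (E \<union> E')" for x
    using that partial_copyD(3)[OF 1] partial_copyD(3)[OF 2] by simp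
  fix w assume w: "w \<in> F"
  have ind: "indicator (E \<union> E') x = indicator E x + (indicator E' x :: real)" for x
    using disj by (auto simp: indicator_def)
  have "L1_norm M (\<lambda>x. indicator (E \<union> E') (T w x) - indicator (E \<union> E') x)
      = L1_norm M (\<lambda>x. (indicator E (T w x) - indicator E x) + (indicator E' (T w x) - indicator E' x))"
    by (rule L1_norm_cong) (simp add: ind)
  also have "\<dots> \<le> L1_norm M (\<lambda>x. indicator E (T w x) - indicator E x) + L1_norm M (\<lambda>x. indicator E' (T w x) - indicator E' x)"
    by (intro L1_norm_add_le Bochner_Integration.integrable_diff integrable_T integrable_indicator_set)
      auto
  finally show "L1_norm M (\<lambda>x. indicator (E \<union> E') (T w x) - indicator (E \<union> E') x) \<le> \<epsilon> + \<delta>"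
    using partial_copyD(6)[OF 1 w] partial_copyD(6)[OF 2 w] by linarith
  have "L1_norm M (\<lambda>x. h (T w x) + h' (T w x) - (h x + h' x))
      = L1_norm M (\<lambda>x. (h (T w x) - h x) + (h' (T w x) - h' x))"
    by (rule L1_norm_cong) simp
  also have "\<dots> \<le> L1_norm M (\<lambda>x. h (T w x) - h x) + L1_norm M (\<lambda>x. h' (T w x) - h' x)"
    by (intro L1_norm_add_le Bochner_Integration.integrable_diff integrable_T h)
  finally show "L1_norm M (\<lambda>x. h (T w x) + h' (T w x) - (h x + h' x)) \<le> \<epsilon> + \<delta>"
    using partial_copyD(7)[OF 1 w] partial_copyD(7)[OF 2 w] by linarith
next
  fix \<phi> :: "real \<Rightarrow> real" assume \<phi>: "\<phi> \<in> borel_measurable borel" "\<phi> 0 = 0"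
  have add: "\<phi> (h x + h' x) = \<phi> (h x) + \<phi> (h' x)" if "x \<in> space M" for x
  proof (cases "x \<in> E")
    case True
    then have "h' x = 0" using that disj partial_copyD(3)[OF 2] by blast
    then show ?thesis by (simp add: \<phi>(2))
  next
    case False
    then have "h x = 0" using that partial_copyD(3)[OF 1] by blast
    then show ?thesis by (simp add: \<phi>(2))
  qed
  note i = partial_copyD(4)[OF 1 \<phi>] partial_copyD(4)[OF 2 \<phi>]
  show "integrable M (\<lambda>x. \<phi> (h x + h' x))"
    using Bochner_Integration.integrable_add[OF i] by (rule Bochner_Integration.integrable_cong[THEN iffD2, rotated -1]) (simp_all add: add)
  have "(\<integral>x. \<phi> (h x + h' x) \<partial>M) = (\<integral>x. \<phi> (h x) + \<phi> (h' x) \<partial>M)"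
    by (rule Bochner_Integration.integral_cong) (simp_all add: add)
  also have "\<dots> = (measure M E + measure M E') * ((\<Sum>r<K. \<phi> (a r)) / real K)"
    using i by (simp add: partial_copyD(5)[OF 1 \<phi>] partial_copyD(5)[OF 2 \<phi>] distrib_right add_divide_distrib)
  also have "measure M E + measure M E' = measure M (E \<union> E')"
    using partial_copyD(1)[OF 1] partial_copyD(1)[OF 2] disj by (simp add: finite_measure_Union)
  finally show "(\<integral>x. \<phi> (h x + h' x) \<partial>M) = measure M (E \<union> E') * ((\<Sum>r<K. \<phi> (a r)) / real K)" .
next
  have h: "integrable M h" "integrable M h'" using 1 2 by (auto intro: partial_copy_integrable)
  have le: "L1_norm M (average T N (\<lambda>x. h x + h' x)) \<le> L1_norm M (average T N h) + L1_norm M (average T N h')" for N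
    using L1_norm_add_le[OF integrable_average[OF h(1)] integrable_average[OF h(2)], of N N]
    by (simp add: average_add[abs_def])
  have lim: "(\<lambda>N. L1_norm M (average T N h) + L1_norm M (average T N h')) \<longlonglongrightarrow> 0"
    using tendsto_add[OF partial_copyD(8)[OF 1] partial_copyD(8)[OF 2]] by simp
  show "(\<lambda>N. L1_norm M (average T N (\<lambda>x. h x + h' x))) \<longlonglongrightarrow> 0"
    by (rule tendsto_sandwich[OF _ _ tendsto_const lim]) (simp_all add: L1_norm_nonneg le)
qed

text \<open>\<open>E\<close> is the disjoint union of K L^d translates of \<open>B\<close>, and each
  index takes an equal share of it. The indicator of \<open>E\<close> is the stack with all values
  1, so one estimate covers the invariance of both \<open>E\<close> and the function; this is why
  \<open>real K\<close> is added to the sum of the \<open>\<bar>a r\<bar>\<close>.\<close>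

lemma partial_copy_stack:
  fixes B :: "'a set" and F :: "(int ^ 'd) set" and K L :: nat
  defines "E \<equiv> {x \<in> space M. \<exists>j\<in>labels K L. T (offset L j) x \<in> B}"
  assumes B [measurable]: "B \<in> sets M" and L: "L \<ge> 1" and K: "K \<ge> 1"
    and disj: "\<And>x j k. x \<in> space M \<Longrightarrow> j \<in> labels K L \<Longrightarrow> k \<in> labels K L \<Longrightarrow>
      T (offset L j) x \<in> B \<Longrightarrow> T (offset L k) x \<in> B \<Longrightarrow> j = k"
    and a: "(\<Sum>r<K. a r) = 0"
    and F: "\<And>w. w \<in> F \<Longrightarrow> ((\<Sum>r<K. \<bar>a r\<bar>) + real K) * folner w L \<le> \<epsilon>"
  shows "measure M E = real K * (real L ^ CARD('d) * measure M B)"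
    and "partial_copy K a F \<epsilon> E (stack K a L B)"
proof -
  let ?one = "\<lambda>_ :: nat. 1 :: real"
  have E: "E \<in> sets M" unfolding E_def by measurable
  have ind: "indicator E x = stack K ?one L B x" if x: "x \<in> space M" for x
  proof -
    have nonneg: "0 \<le> (indicator B (T (offset L j) x) :: real)" for j by simp
    \<comment> \<open>The stack with all values 1 is fixed by the map sending nonzero numbers to 1,
      so it takes only the values 0 and 1.\<close>
    have "(\<lambda>t. if t = 0 then 0 else 1) (stack K ?one L B x) = stack K (\<lambda>r. if ?one r = 0 then 0 else 1) L B x"
      by (rule stack_compose) (use disj x in auto)
    moreover have "stack K ?one L B x = 0 \<longleftrightarrow> (\<forall>j\<in>labels K L. T (offset L j) x \<notin> B)"
      unfolding stack_def by (simp add: sum_nonneg_eq_0_iff indicator_eq_0_iff)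
    ultimately show ?thesis using x by (auto simp: E_def indicator_def split: if_splits)
  qed
  have "measure M E = (\<integral>x. indicator E x \<partial>M)" using E by simp
  also have "\<dots> = (\<integral>x. stack K ?one L B x \<partial>M)"
    by (rule Bochner_Integration.integral_cong) (simp_all add: ind)
  finally have "measure M E = (\<integral>x. stack K ?one L B x \<partial>M)" .
  then show mE: "measure M E = real K * (real L ^ CARD('d) * measure M B)"
    by (simp add: integral_stack)
  have Bb: "real L ^ CARD('d) * measure M B \<le> 1"
  proof -
    have "real L ^ CARD('d) * measure M B \<le> measure M E"
      unfolding mE using K mult_right_mono[of 1 "real K" "real L ^ CARD('d) * measure M B"] by simp
    then show ?thesis using prob_le_1[of E] by linarith
  qed
  have inv: "L1_norm M (\<lambda>x. stack K b L B (T w x) - stack K b L B x) \<le> \<epsilon>"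
    if w: "w \<in> F" and b: "(\<Sum>r<K. \<bar>b r\<bar>) \<le> (\<Sum>r<K. \<bar>a r\<bar>) + real K" for w b
  proof -
    have fol: "0 \<le> folner w L" by (simp add: folner_def)
    have "L1_norm M (\<lambda>x. stack K b L B (T w x) - stack K b L B x)
        \<le> (\<Sum>r<K. \<bar>b r\<bar>) * folner w L * (real L ^ CARD('d) * measure M B)"
      by (rule L1_norm_stack_shift[OF B L])
    also have "\<dots> \<le> (\<Sum>r<K. \<bar>b r\<bar>) * folner w L * 1"
      using Bb fol by (intro mult_left_mono mult_nonneg_nonneg sum_nonneg) auto
    also have "\<dots> \<le> ((\<Sum>r<K. \<bar>a r\<bar>) + real K) * folner w L"
      using mult_right_mono[OF b fol] by simp
    finally show ?thesis using F[OF w] by linarith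
  qed
  show "partial_copy K a F \<epsilon> E (stack K a L B)"
    unfolding partial_copy_def
  proof (intro conjI ballI impI)
    show "E \<in> events" by fact
    show "stack K a L B \<in> borel_measurable M" using integrable_stack[OF B] by auto
    show "stack K a L B x = 0" if "x \<in> space M - E" for x
      using that unfolding E_def stack_def by (intro sum.neutral) auto
    show "L1_norm M (\<lambda>x. stack K a L B (T w x) - stack K a L B x) \<le> \<epsilon>" if "w \<in> F" for w
      using that by (intro inv) auto
    show "L1_norm M (\<lambda>x. indicator E (T w x) - indicator E x) \<le> \<epsilon>" if "w \<in> F" for w
    proof -
      have "L1_norm M (\<lambda>x. indicator E (T w x) - indicator E x)
          = L1_norm M (\<lambda>x. stack K ?one L B (T w x) - stack K ?one L B x)"
        by (rule L1_norm_cong) (simp add: ind T_space)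
      also have "\<dots> \<le> \<epsilon>" using that by (intro inv) (auto intro: sum_nonneg)
      finally show ?thesis .
    qed
    show "(\<lambda>N. L1_norm M (average T N (stack K a L B))) \<longlonglongrightarrow> 0"
      by (rule L1_norm_average_stack_tendsto_0[OF B a])
    fix \<phi> :: "real \<Rightarrow> real" assume \<phi>: "\<phi> \<in> borel_measurable borel" "\<phi> 0 = 0"
    have eq: "\<phi> (stack K a L B x) = stack K (\<lambda>r. \<phi> (a r)) L B x" if "x \<in> space M" for x
      by (rule stack_compose) (use disj that \<phi> in auto)
    show "integrable M (\<lambda>x. \<phi> (stack K a L B x))"
      using integrable_stack[OF B, of K "\<lambda>r. \<phi> (a r)" L]
      by (rule Bochner_Integration.integrable_cong[THEN iffD2, rotated -1]) (simp_all add: eq)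
    have "(\<integral>x. \<phi> (stack K a L B x) \<partial>M) = (\<integral>x. stack K (\<lambda>r. \<phi> (a r)) L B x \<partial>M)"
      by (rule Bochner_Integration.integral_cong) (simp_all add: eq)
    then show "(\<integral>x. \<phi> (stack K a L B x) \<partial>M) = measure M E * ((\<Sum>r<K. \<phi> (a r)) / real K)"
      using K by (simp add: integral_stack[OF B] mE)
  qed
qed

section \<open>Covering a fixed proportion of the complement\<close>

text \<open>By maximality the translates of \<open>B\<close> by offset differences cover
  \<open>C\<close>. There are at most K^2 (2L)^d of them, while \<open>E\<close> has measure K L^d
  times that of \<open>B\<close>, so \<open>E\<close> has at least the fraction 1/(K 2^d) of the
  measure of \<open>C\<close>. The set \<open>G\<close> is fixed before \<open>A\<close>, so
  \<open>A\<close> can be chosen almost invariant under it.\<close>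

lemma disjoint_partial_copy:
  fixes U :: "'a \<Rightarrow> real"
  assumes U: "U \<in> borel_measurable M" and X [measurable]: "X \<in> sets M" and X1: "measure M X = 1"
    and sep: "\<And>x w. x \<in> X \<Longrightarrow> w \<noteq> 0 \<Longrightarrow> U (T w x) \<noteq> U x"
    and K: "K \<ge> 1" and a: "(\<Sum>r<K. a r) = 0"
    and F: "finite F" and \<epsilon>: "\<epsilon> > 0"
  obtains G where "finite G" "\<And>A. A \<in> sets M \<Longrightarrow> \<exists>E h. E \<inter> A = {} \<and> partial_copy K a F \<epsilon> E h \<and>
      1 - measure M A - (\<Sum>w\<in>G. measure M {x \<in> space M. x \<notin> A \<and> T w x \<in> A})
        \<le> real K * 2 ^ CARD('d) * measure M E"
proof -
  let ?s = "(\<Sum>r<K. \<bar>a r\<bar>) + real K"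
  have "\<forall>\<^sub>F L in sequentially. ?s * folner w L \<le> \<epsilon>" for w :: "int ^ 'd"
  proof -
    have "(\<lambda>L. ?s * folner w L) \<longlonglongrightarrow> ?s * 0" by (intro tendsto_intros folner_tendsto_0)
    then show ?thesis using \<epsilon> by (auto dest!: order_tendstoD(2)[where a = \<epsilon>] elim: eventually_mono)
  qed
  then have "\<forall>\<^sub>F L in sequentially. \<forall>w\<in>F. ?s * folner w L \<le> \<epsilon>"
    using F by (simp add: eventually_ball_finite)
  then have "\<forall>\<^sub>F L in sequentially. (\<forall>w\<in>F. ?s * folner w L \<le> \<epsilon>) \<and> L \<ge> 1"
    using eventually_ge_at_top[of 1] by (rule eventually_conj)
  then obtain L where L: "\<And>w. w \<in> F \<Longrightarrow> ?s * folner w L \<le> \<epsilon>" "L \<ge> 1"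
    by (auto simp: eventually_sequentially)
  define G where "G = (\<lambda>j. - offset L j) ` (labels K L :: (nat \<times> (int ^ 'd)) set)"
  show thesis
  proof
    show G_fin: "finite G" by (simp add: G_def)
    fix A assume A [measurable]: "A \<in> sets M"
    \<comment> \<open>Bases in \<open>C\<close> produce translates that avoid \<open>A\<close>. Up
      to a null set, the complement of \<open>A\<close> loses only the points that some element of
      \<open>G\<close> moves into \<open>A\<close>.\<close>
    define C where "C = {x \<in> space M. x \<in> X \<and> x \<notin> A \<and> (\<forall>w\<in>G. T w x \<notin> A)}"
    have C [measurable]: "C \<in> sets M" unfolding C_def using G_fin by measurable
    let ?\<Delta> = "offset_differences K L :: (int ^ 'd) set"
    have sym: "- w \<in> ?\<Delta> - {0}" if "w \<in> ?\<Delta> - {0}" for w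
      using that unfolding offset_differences_def by force
    obtain B where B [measurable]: "B \<in> sets M" and BC: "B \<subseteq> C"
      and indep: "\<And>x w. x \<in> B \<Longrightarrow> w \<in> ?\<Delta> - {0} \<Longrightarrow> T w x \<notin> B"
      and max: "\<And>x. x \<in> C \<Longrightarrow> x \<in> B \<or> (\<exists>w\<in>?\<Delta> - {0}. T w x \<in> B)"
      using maximal_independent_set[of U C "?\<Delta> - {0}"] U C sym sep
      by (auto simp: C_def)
    have disj: "j = k" if x: "x \<in> space M" and j: "j \<in> labels K L" and k: "k \<in> labels K L"
      and jB: "T (offset L j) x \<in> B" and kB: "T (offset L k) x \<in> B" for x j k
    proof (rule ccontr)
      assume "j \<noteq> k"
      then have "offset L k - offset L j \<noteq> 0" using inj_on_offset j k by (metis inj_onD eq_iff_diff_eq_0)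
      then have "offset L k - offset L j \<in> ?\<Delta> - {0}"
        using j k by (auto simp: offset_differences_def intro!: image_eqI[of _ _ "(k, j)"])
      from indep[OF jB this] kB x show False by (simp add: T_add)
    qed
    define E where "E = {x \<in> space M. \<exists>j\<in>labels K L. T (offset L j) x \<in> B}"
    have E: "measure M E = real K * (real L ^ CARD('d) * measure M B)"
      "partial_copy K a F \<epsilon> E (stack K a L B)"
      unfolding E_def using partial_copy_stack[OF B L(2) K disj a L(1)] by auto
    have "E \<inter> A = {}"
    proof (rule ccontr)
      assume "E \<inter> A \<noteq> {}"
      then obtain x j where x: "x \<in> space M" "x \<in> A" "j \<in> labels K L" "T (offset L j) x \<in> B"
        by (auto simp: E_def)
      then have "T (- offset L j) (T (offset L j) x) \<notin> A" using BC by (auto simp: C_def G_def)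
      then show False using x by (simp add: T_add T_zero)
    qed
    moreover have "1 - measure M A - (\<Sum>w\<in>G. measure M {x \<in> space M. x \<notin> A \<and> T w x \<in> A})
        \<le> real K * 2 ^ CARD('d) * measure M E"
    proof -
      let ?Q = "\<lambda>w. {x \<in> space M. x \<notin> A \<and> T w x \<in> A}"
      have Q: "?Q w \<in> sets M" for w by measurable
      have "X \<subseteq> C \<union> (A \<union> (\<Union>w\<in>G. ?Q w))" using sets.sets_into_space[OF X] by (auto simp: C_def)
      then have "measure M X \<le> measure M (C \<union> (A \<union> (\<Union>w\<in>G. ?Q w)))"
        using G_fin by (intro finite_measure_mono) measurable
      also have "\<dots> \<le> measure M C + measure M (A \<union> (\<Union>w\<in>G. ?Q w))"
        using G_fin by (intro measure_Un_le) measurable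
      also have "measure M (A \<union> (\<Union>w\<in>G. ?Q w)) \<le> measure M A + measure M (\<Union>w\<in>G. ?Q w)"
        using G_fin by (intro measure_Un_le) measurable
      also have "measure M (\<Union>w\<in>G. ?Q w) \<le> (\<Sum>w\<in>G. measure M (?Q w))"
        using G_fin Q by (intro finite_measure_subadditive_finite) auto
      finally have "1 - measure M A - (\<Sum>w\<in>G. measure M (?Q w)) \<le> measure M C" using X1 by simp
      also have "measure M C \<le> measure M (\<Union>w\<in>?\<Delta>. {x \<in> space M. T w x \<in> B})"
      proof (rule finite_measure_mono)
        show "C \<subseteq> (\<Union>w\<in>?\<Delta>. {x \<in> space M. T w x \<in> B})"
        proof
          fix x assume x: "x \<in> C"
          then have xs: "x \<in> space M" by (simp add: C_def)
          \<comment> \<open>Any label would do: it puts 0 among the differences, which accounts for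
            the points of \<open>B\<close> itself.\<close>
          have "(0, 1) \<in> (labels K L :: (nat \<times> (int ^ 'd)) set)" using K L(2) by (auto simp: labels_def cube_def)
          then have "0 \<in> ?\<Delta>" unfolding offset_differences_def by force
          with max[OF x] have "\<exists>w\<in>?\<Delta>. T w x \<in> B" using T_zero[OF xs] by (metis DiffD1)
          with xs show "x \<in> (\<Union>w\<in>?\<Delta>. {x \<in> space M. T w x \<in> B})" by blast
        qed
      qed measurable
      also have "\<dots> \<le> (\<Sum>w\<in>?\<Delta>. measure M {x \<in> space M. T w x \<in> B})"
        by (intro finite_measure_subadditive_finite) auto
      also have "\<dots> = real (card ?\<Delta>) * measure M B"
      proof -
        have "measure M {x \<in> space M. T w x \<in> B} = measure M B" for w
        proof -
          have "measure M B = measure (distr M M (T w)) B" by (simp add: distr_T)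
          also have "\<dots> = measure M (T w -` B \<inter> space M)" by (rule measure_distr) auto
          also have "T w -` B \<inter> space M = {x \<in> space M. T w x \<in> B}" by auto
          finally show ?thesis ..
        qed
        then show ?thesis by simp
      qed
      also have "\<dots> \<le> real (K * K * (2 * L) ^ CARD('d)) * measure M B"
        by (intro mult_right_mono of_nat_mono card_offset_differences) auto
      also have "\<dots> = real K * 2 ^ CARD('d) * measure M E"
        by (simp add: E(1) power_mult_distrib ac_simps)
      finally show ?thesis .
    qed
    ultimately show "\<exists>E h. E \<inter> A = {} \<and> partial_copy K a F \<epsilon> E h \<and>
      1 - measure M A - (\<Sum>w\<in>G. measure M {x \<in> space M. x \<notin> A \<and> T w x \<in> A})
        \<le> real K * 2 ^ CARD('d) * measure M E" using E(2) by blast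
  qed
qed

text \<open>Each round captures a fixed fraction of what is uncovered, so the uncovered measure
  decays geometrically. The scale of the last piece, hence \<open>G\<close>, is fixed first, and the
  induction hypothesis then supplies the earlier pieces almost invariant under \<open>G\<close>;
  this is why it must hold for all \<open>F\<close> and \<epsilon>.\<close>

lemma partial_copy_exhaustion:
  fixes U :: "'a \<Rightarrow> real"
  assumes U: "U \<in> borel_measurable M" and X: "X \<in> sets M" "measure M X = 1"
    and sep: "\<And>x w. x \<in> X \<Longrightarrow> w \<noteq> 0 \<Longrightarrow> U (T w x) \<noteq> U x"
    and K: "K \<ge> 1" and a: "(\<Sum>r<K. a r) = 0"
    and F: "finite F" and \<epsilon>: "\<epsilon> > 0" and \<eta>: "\<eta> > 0"
  shows "\<exists>E h. partial_copy K a F \<epsilon> E h \<and> 1 - measure M E \<le> \<eta>"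
proof -
  \<comment> \<open>\<theta> is the fraction captured in one round. Half of it is given up in
    \<open>q\<close> to absorb the points near the boundary of the covered set.\<close>
  define \<theta> where "\<theta> = 1 / (real K * 2 ^ CARD('d))"
  have "1 * 1 \<le> real K * 2 ^ CARD('d)" using K by (intro mult_mono) auto
  then have \<theta>: "0 < \<theta>" "\<theta> \<le> 1" by (simp_all add: \<theta>_def field_simps)
  define q where "q = 1 - \<theta> / 2"
  have q: "0 < q" "q < 1" using \<theta> by (simp_all add: q_def)
  have steps: "\<exists>E h. partial_copy K a F \<epsilon> E h \<and> 1 - measure M E \<le> q ^ n"
    if "finite F" "\<epsilon> > 0" for n F \<epsilon>
    using that
  proof (induction n arbitrary: F \<epsilon>)
    case 0
    then show ?case using partial_copy_empty[of \<epsilon> K a F] by (intro exI[of _ "{}"] exI[of _ "\<lambda>_. 0"]) auto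
  next
    case (Suc n)
    have "\<epsilon> / 2 > 0" using Suc.prems by simp
    from disjoint_partial_copy[OF U X sep K a \<open>finite F\<close> this]
    obtain G where G: "finite G" and step: "\<And>A. A \<in> sets M \<Longrightarrow> \<exists>E h. E \<inter> A = {} \<and> partial_copy K a F (\<epsilon> / 2) E h \<and>
        1 - measure M A - (\<Sum>w\<in>G. measure M {x \<in> space M. x \<notin> A \<and> T w x \<in> A})
          \<le> real K * 2 ^ CARD('d) * measure M E" by blast
    \<comment> \<open>The boundary terms, one for each element of \<open>G\<close>, then add up to
      at most \<open>q ^ n / 2\<close>; the summand 1 keeps the denominator positive.\<close>
    define \<zeta> where "\<zeta> = q ^ n / (2 * (real (card G) + 1))"
    have \<zeta>: "\<zeta> > 0" using q by (simp add: \<zeta>_def add_nonneg_pos)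
    have "finite (F \<union> G)" "min (\<epsilon> / 2) \<zeta> > 0" using Suc.prems G \<zeta> by auto
    from Suc.IH[OF this] obtain A h where Ah: "partial_copy K a (F \<union> G) (min (\<epsilon> / 2) \<zeta>) A h"
      and An: "1 - measure M A \<le> q ^ n" by blast
    have A [measurable]: "A \<in> sets M" by (rule partial_copyD(1)[OF Ah])
    from step[OF A] obtain E g where E: "E \<inter> A = {}" "partial_copy K a F (\<epsilon> / 2) E g"
      "1 - measure M A - (\<Sum>w\<in>G. measure M {x \<in> space M. x \<notin> A \<and> T w x \<in> A})
          \<le> real K * 2 ^ CARD('d) * measure M E" by blast
    have "measure M {x \<in> space M. x \<notin> A \<and> T w x \<in> A} \<le> \<zeta>" if "w \<in> G" for w
    proof -
      have "measure M {x \<in> space M. x \<notin> A \<and> T w x \<in> A} = L1_norm M (indicator {x \<in> space M. x \<notin> A \<and> T w x \<in> A})"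
        by (intro L1_norm_indicator[symmetric]) measurable
      also have "\<dots> \<le> L1_norm M (\<lambda>x. indicator A (T w x) - indicator A x)"
        by (intro L1_norm_mono Bochner_Integration.integrable_diff integrable_T integrable_indicator_set)
          (auto simp: indicator_def)
      also have "\<dots> \<le> \<zeta>" using partial_copyD(6)[OF Ah, of w] that by simp
      finally show ?thesis .
    qed
    then have "(\<Sum>w\<in>G. measure M {x \<in> space M. x \<notin> A \<and> T w x \<in> A}) \<le> real (card G) * \<zeta>"
      using sum_bounded_above[of G "\<lambda>w. measure M {x \<in> space M. x \<notin> A \<and> T w x \<in> A}" \<zeta>] by simp
    also have "\<dots> \<le> q ^ n / 2"
      using q by (simp add: \<zeta>_def field_simps)
    finally have "1 - measure M A - q ^ n / 2 \<le> real K * 2 ^ CARD('d) * measure M E"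
      using E(3) by linarith
    then have "\<theta> * (1 - measure M A - q ^ n / 2) \<le> measure M E"
      using K by (simp add: \<theta>_def field_simps)
    then have "1 - measure M A - measure M E \<le> (1 - \<theta>) * (1 - measure M A) + \<theta> * q ^ n / 2"
      by (simp add: algebra_simps)
    also have "\<dots> \<le> (1 - \<theta>) * q ^ n + \<theta> * q ^ n / 2"
      using \<theta> An by (intro add_mono mult_left_mono) auto
    also have "\<dots> = q ^ Suc n" by (simp add: q_def algebra_simps)
    finally have meas: "1 - measure M A - measure M E \<le> q ^ Suc n" .
    have "partial_copy K a F (\<epsilon> / 2 + \<epsilon> / 2) (A \<union> E) (\<lambda>x. h x + g x)"
      using partial_copy_mono[OF Ah, of F "\<epsilon> / 2"] E(1,2) by (intro partial_copy_Un) auto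
    moreover have "measure M (A \<union> E) = measure M A + measure M E"
      using E(1) partial_copyD(1)[OF E(2)] by (intro finite_measure_Union) auto
    ultimately show ?case using meas
      by (intro exI[of _ "A \<union> E"] exI[of _ "\<lambda>x. h x + g x"]) simp
  qed
  obtain n where "q ^ n < \<eta>" using real_arch_pow_inv[OF \<eta> q(2)] by blast
  with steps[OF F \<epsilon>, of n] show ?thesis by (meson less_imp_le order_trans)
qed

end

section \<open>Approximation of distributions\<close>

text \<open>
  The modulus of continuity that makes \<open>g \<mapsto> \<integral> \<phi> (g x)\<close> continuous in \<open>L\<^sub>1\<close>. It is shared by the
  functions in \<^term>\<open>C0\<close> and the absolute value.
\<close>

definition almost_lipschitz :: "(real \<Rightarrow> real) \<Rightarrow> bool" where
  "almost_lipschitz \<phi> \<longleftrightarrow> (\<forall>\<epsilon>>0. \<exists>C\<ge>0. \<forall>x y. \<bar>\<phi> x - \<phi> y\<bar> \<le> \<epsilon> + C * \<bar>x - y\<bar>)"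

lemma almost_lipschitz_abs: "almost_lipschitz abs"
  unfolding almost_lipschitz_def by (intro allI impI exI[of _ 1]) auto

text \<open>Such a function is uniformly continuous and bounded. Close arguments are handled by
  \<epsilon>, and for arguments at least \<delta> apart the bound 2S is at most 2S/\<delta> times
  their distance.\<close>

lemma almost_lipschitz_C0:
  assumes "\<phi> \<in> C0"
  shows "almost_lipschitz \<phi>"
  unfolding almost_lipschitz_def
proof (intro allI impI)
  fix \<epsilon> :: real assume \<epsilon>: "\<epsilon> > 0"
  have c: "continuous_on UNIV \<phi>" and l: "(\<phi> \<longlongrightarrow> 0) at_infinity"
    using assms by (auto simp: C0_def)
  from l have "\<forall>\<^sub>F t in at_infinity. dist (\<phi> t) 0 < \<epsilon> / 2"
    by (rule tendstoD) (use \<epsilon> in simp)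
  then obtain b where b: "\<And>t. norm t \<ge> b \<Longrightarrow> \<bar>\<phi> t\<bar> < \<epsilon> / 2"
    by (auto simp: eventually_at_infinity)
  have "uniformly_continuous_on (cball 0 (b + 1)) \<phi>"
    by (intro compact_uniformly_continuous continuous_on_subset[OF c]) auto
  then obtain \<delta>0 where \<delta>0: "\<delta>0 > 0"
    "\<And>x y. x \<in> cball 0 (b + 1) \<Longrightarrow> y \<in> cball 0 (b + 1) \<Longrightarrow> dist y x < \<delta>0 \<Longrightarrow> dist (\<phi> y) (\<phi> x) < \<epsilon>"
    using \<epsilon> unfolding uniformly_continuous_on_def by blast
  \<comment> \<open>With \<delta> at most 1, two close points that are not both in the ball of
    radius \<open>b + 1\<close> both have absolute value at least \<open>b\<close>, where \<phi> is
    small.\<close>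
  define \<delta> where "\<delta> = min \<delta>0 1"
  have \<delta>: "\<delta> > 0" using \<delta>0 by (simp add: \<delta>_def)
  define S where "S = (SUP t. \<bar>\<phi> t\<bar>)"
  have S: "\<bar>\<phi> t\<bar> \<le> S" for t unfolding S_def by (rule C0_abs_le_SUP[OF assms])
  have S0: "0 \<le> S" using S[of 0] by simp
  have "\<bar>\<phi> x - \<phi> y\<bar> \<le> \<epsilon> + 2 * S / \<delta> * \<bar>x - y\<bar>" for x y
  proof (cases "\<bar>x - y\<bar> < \<delta>")
    case True
    have "\<bar>\<phi> x - \<phi> y\<bar> \<le> \<epsilon>"
    proof (cases "\<bar>x\<bar> \<le> b + 1 \<and> \<bar>y\<bar> \<le> b + 1")
      case True
      then show ?thesis using \<delta>0(2)[of y x] \<open>\<bar>x - y\<bar> < \<delta>\<close> by (simp add: \<delta>_def dist_real_def)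
    next
      case False
      then have "\<bar>x\<bar> \<ge> b" "\<bar>y\<bar> \<ge> b" using \<open>\<bar>x - y\<bar> < \<delta>\<close> by (auto simp: \<delta>_def)
      then show ?thesis using b[of x] b[of y] by simp
    qed
    moreover have "0 \<le> 2 * S / \<delta> * \<bar>x - y\<bar>" using S0 \<delta> by simp
    ultimately show ?thesis by linarith
  next
    case False
    have "\<bar>\<phi> x - \<phi> y\<bar> \<le> 2 * S" using S[of x] S[of y] by linarith
    also have "\<dots> = 2 * S / \<delta> * \<delta>" using \<delta> by simp
    also have "\<dots> \<le> 2 * S / \<delta> * \<bar>x - y\<bar>" using False S0 \<delta> by (intro mult_left_mono) auto
    finally show ?thesis using \<epsilon> by linarith
  qed
  moreover have "0 \<le> 2 * S / \<delta>" using S0 \<delta> by simp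
  ultimately show "\<exists>C\<ge>0. \<forall>x y. \<bar>\<phi> x - \<phi> y\<bar> \<le> \<epsilon> + C * \<bar>x - y\<bar>" by blast
qed

lemma almost_lipschitz_uniform:
  assumes "finite \<Phi>" "\<And>\<phi>. \<phi> \<in> \<Phi> \<Longrightarrow> almost_lipschitz \<phi>" "\<epsilon> > 0"
  obtains C where "C \<ge> 0" "\<And>\<phi> x y. \<phi> \<in> \<Phi> \<Longrightarrow> \<bar>\<phi> x - \<phi> y\<bar> \<le> \<epsilon> + C * \<bar>x - y\<bar>"
proof -
  have "\<forall>\<phi>\<in>\<Phi>. \<exists>C\<ge>0. \<forall>x y. \<bar>\<phi> x - \<phi> y\<bar> \<le> \<epsilon> + C * \<bar>x - y\<bar>"
    using assms(2,3) by (auto simp: almost_lipschitz_def)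
  then obtain c where c: "\<And>\<phi>. \<phi> \<in> \<Phi> \<Longrightarrow> c \<phi> \<ge> 0"
    "\<And>\<phi> x y. \<phi> \<in> \<Phi> \<Longrightarrow> \<bar>\<phi> x - \<phi> y\<bar> \<le> \<epsilon> + c \<phi> * \<bar>x - y\<bar>" by metis
  show thesis
  proof
    show "0 \<le> sum c \<Phi>" using c(1) by (rule sum_nonneg)
    fix \<phi> x y assume \<phi>: "\<phi> \<in> \<Phi>"
    have "c \<phi> \<le> sum c \<Phi>" using assms(1) \<phi> c(1) by (intro member_le_sum) auto
    then have "c \<phi> * \<bar>x - y\<bar> \<le> sum c \<Phi> * \<bar>x - y\<bar>" by (rule mult_right_mono) simp
    with c(2)[OF \<phi>, of x y] show "\<bar>\<phi> x - \<phi> y\<bar> \<le> \<epsilon> + sum c \<Phi> * \<bar>x - y\<bar>" by linarith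
  qed
qed

section \<open>Empirical approximation and series in L1\<close>

context prob_space
begin

lemma integrable_almost_lipschitz:
  assumes f: "integrable M f" and \<phi>: "almost_lipschitz \<phi>" "\<phi> \<in> borel_measurable borel"
  shows "integrable M (\<lambda>x. \<phi> (f x))"
proof -
  obtain C where C: "C \<ge> 0" "\<And>x y. \<bar>\<phi> x - \<phi> y\<bar> \<le> 1 + C * \<bar>x - y\<bar>"
    using \<phi>(1) unfolding almost_lipschitz_def by (metis zero_less_one)
  show ?thesis
  proof (rule Bochner_Integration.integrable_bound)
    show "integrable M (\<lambda>x. \<bar>\<phi> 0\<bar> + 1 + C * \<bar>f x\<bar>)" using f by auto
    show "(\<lambda>x. \<phi> (f x)) \<in> borel_measurable M" using f \<phi>(2) by measurable
    have "\<bar>\<phi> t\<bar> \<le> \<bar>\<bar>\<phi> 0\<bar> + 1 + C * \<bar>t\<bar>\<bar>" for t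
    proof -
      have "0 \<le> C * \<bar>t\<bar>" using C(1) by simp
      then show ?thesis using C(2)[of t 0] by simp
    qed
    then show "AE x in M. norm (\<phi> (f x)) \<le> norm (\<bar>\<phi> 0\<bar> + 1 + C * \<bar>f x\<bar>)" by simp
  qed
qed

lemma integral_almost_lipschitz_diff_le:
  assumes f: "integrable M f" and g: "integrable M g"
    and i: "integrable M (\<lambda>x. \<phi> (f x))" "integrable M (\<lambda>x. \<phi> (g x))"
    and C: "\<And>x y. \<bar>\<phi> x - \<phi> y\<bar> \<le> \<epsilon> + C * \<bar>x - y\<bar>"
  shows "\<bar>(\<integral>x. \<phi> (f x) \<partial>M) - (\<integral>x. \<phi> (g x) \<partial>M)\<bar> \<le> \<epsilon> + C * L1_norm M (\<lambda>x. f x - g x)"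
proof -
  have "\<bar>(\<integral>x. \<phi> (f x) \<partial>M) - (\<integral>x. \<phi> (g x) \<partial>M)\<bar> = \<bar>\<integral>x. \<phi> (f x) - \<phi> (g x) \<partial>M\<bar>"
    using i by simp
  also have "\<dots> \<le> (\<integral>x. \<bar>\<phi> (f x) - \<phi> (g x)\<bar> \<partial>M)" by (rule integral_abs_bound)
  also have "\<dots> \<le> (\<integral>x. \<epsilon> + C * \<bar>f x - g x\<bar> \<partial>M)"
    using i f g C by (intro integral_mono) auto
  also have "\<dots> = \<epsilon> + C * L1_norm M (\<lambda>x. f x - g x)"
    using f g by (simp add: L1_norm_def prob_space)
  finally show ?thesis .
qed

lemma simple_function_L1_dense:
  fixes f :: "'a \<Rightarrow> real"
  assumes f: "integrable M f" and \<epsilon>: "\<epsilon> > 0"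
  obtains s where "simple_function M s" "integrable M s" "L1_norm M (\<lambda>x. s x - f x) < \<epsilon>"
proof -
  obtain F where F': "\<forall>i. simple_function M (F i)" "\<forall>x\<in>space M. (\<lambda>i. F i x) \<longlonglongrightarrow> f x"
      "\<forall>i. \<forall>x\<in>space M. dist (F i x) 0 \<le> 2 * dist (f x) 0"
    using borel_measurable_implies_sequence_metric[of f M 0] f by blast
  then have F: "\<And>i. simple_function M (F i)" "\<And>x. x \<in> space M \<Longrightarrow> (\<lambda>i. F i x) \<longlonglongrightarrow> f x"
      "\<And>i x. x \<in> space M \<Longrightarrow> \<bar>F i x\<bar> \<le> 2 * \<bar>f x\<bar>"
    by simp_all
  have meas: "F i \<in> borel_measurable M" for i using F(1) by (rule borel_measurable_simple_function)
  have "(\<lambda>i. \<integral>x. \<bar>F i x - f x\<bar> \<partial>M) \<longlonglongrightarrow> (\<integral>x. 0 \<partial>M)"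
  proof (rule integral_dominated_convergence[where w = "\<lambda>x. 3 * \<bar>f x\<bar>"])
    show "AE x in M. (\<lambda>i. \<bar>F i x - f x\<bar>) \<longlonglongrightarrow> 0"
    proof (rule AE_I2)
      fix x assume "x \<in> space M"
      from tendsto_rabs[OF tendsto_diff[OF F(2)[OF this] tendsto_const[of "f x"]]]
      show "(\<lambda>i. \<bar>F i x - f x\<bar>) \<longlonglongrightarrow> 0" by simp
    qed
    show "AE x in M. norm \<bar>F i x - f x\<bar> \<le> 3 * \<bar>f x\<bar>" for i
    proof (rule AE_I2)
      fix x assume "x \<in> space M"
      from F(3)[OF this, of i] show "norm \<bar>F i x - f x\<bar> \<le> 3 * \<bar>f x\<bar>" by simp
    qed
  qed (use f meas in auto)
  then have "\<forall>\<^sub>F i in sequentially. (\<integral>x. \<bar>F i x - f x\<bar> \<partial>M) < \<epsilon>"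
    using \<epsilon> by (auto dest: order_tendstoD(2))
  then obtain i where "L1_norm M (\<lambda>x. F i x - f x) < \<epsilon>"
    by (auto simp: eventually_sequentially L1_norm_def)
  moreover have "integrable M (F i)"
    by (rule Bochner_Integration.integrable_bound[where f = "\<lambda>x. 2 * \<bar>f x\<bar>"]) (use f meas F(3) in auto)
  ultimately show thesis using F(1) that by blast
qed

text \<open>In a list of length \<open>K\<close> each value \<open>v\<close> is repeated floor(K
  p(v)) times and the places left over are filled with 0. Their proportion tends to 0, and since
  there are finitely many values no regularity of \<phi> is needed.\<close>

lemma simple_function_empirical:
  fixes s :: "'a \<Rightarrow> real"
  assumes s: "simple_function M s"
  obtains xs :: "nat \<Rightarrow> nat \<Rightarrow> real"
  where "\<And>\<phi> :: real \<Rightarrow> real. (\<lambda>K. (\<Sum>r<K. \<phi> (xs K r)) / real K) \<longlonglongrightarrow> (\<integral>x. \<phi> (s x) \<partial>M)"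
proof -
  define V where "V = s ` space M"
  have V: "finite V" using s by (simp add: V_def simple_function_def)
  define p where "p v = measure M (s -` {v} \<inter> space M)" for v
  have sets: "s -` {v} \<inter> space M \<in> sets M" for v using s by (rule simple_functionD(2))
  have int: "(\<integral>x. \<phi> (s x) \<partial>M) = (\<Sum>v\<in>V. p v * \<phi> v)" for \<phi> :: "real \<Rightarrow> real"
  proof -
    have "(\<integral>x. \<phi> (s x) \<partial>M) = (\<integral>x. (\<Sum>v\<in>V. indicator (s -` {v} \<inter> space M) x * \<phi> v) \<partial>M)"
    proof (rule Bochner_Integration.integral_cong[OF refl])
      fix x assume x: "x \<in> space M"
      have "(\<Sum>v\<in>V. indicator (s -` {v} \<inter> space M) x * \<phi> v) = (\<Sum>v\<in>V. if v = s x then \<phi> v else 0)"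
        using x by (intro sum.cong) (auto simp: indicator_def)
      then show "\<phi> (s x) = (\<Sum>v\<in>V. indicator (s -` {v} \<inter> space M) x * \<phi> v)"
        using x V by (simp add: V_def)
    qed
    also have "\<dots> = (\<Sum>v\<in>V. p v * \<phi> v)"
      using sets by (subst Bochner_Integration.integral_sum) (auto simp: p_def less_top[symmetric])
    finally show ?thesis .
  qed
  have p1: "(\<Sum>v\<in>V. p v) = 1" using int[of "\<lambda>_. 1"] by (simp add: prob_space)
  have p0: "0 \<le> p v" for v by (simp add: p_def)
  define n where "n K v = nat \<lfloor>real K * p v\<rfloor>" for K v
  have n_le: "real (n K v) \<le> real K * p v" and n_ge: "real K * p v - 1 \<le> real (n K v)" for K v
    using p0[of v] by (simp_all add: n_def of_nat_nat)
  have n_lim: "(\<lambda>K. real (n K v) / real K) \<longlonglongrightarrow> p v" for v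
  proof (rule tendsto_sandwich[of "\<lambda>K. p v - 1 / real K" _ _ "\<lambda>_. p v"])
    have "(\<lambda>K. p v - 1 / real K) \<longlonglongrightarrow> p v - 0" by (intro tendsto_intros lim_const_over_n)
    then show "(\<lambda>K. p v - 1 / real K) \<longlonglongrightarrow> p v" by simp
    show "\<forall>\<^sub>F K in sequentially. p v - 1 / real K \<le> real (n K v) / real K"
      using eventually_gt_at_top[of 0]
    proof eventually_elim
      case (elim K)
      then show ?case using divide_right_mono[OF n_ge[of K v], of "real K"] by (simp add: diff_divide_distrib)
    qed
    show "\<forall>\<^sub>F K in sequentially. real (n K v) / real K \<le> p v"
      using eventually_gt_at_top[of 0]
    proof eventually_elim
      case (elim K)
      then show ?case using divide_right_mono[OF n_le[of K v], of "real K"] by simp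
    qed
  qed auto
  have sum_n: "(\<Sum>v\<in>V. n K v) \<le> K" for K
  proof -
    have "real (\<Sum>v\<in>V. n K v) \<le> (\<Sum>v\<in>V. real K * p v)" by (simp add: n_le sum_mono)
    also have "\<dots> = real K" by (simp add: p1 flip: sum_distrib_left)
    finally show ?thesis by (simp only: of_nat_le_iff)
  qed
  obtain vs where vs: "set vs = V" "distinct vs" using finite_distinct_list[OF V] by blast
  define l where "l K = concat (map (\<lambda>v. replicate (n K v) v) vs) @ replicate (K - (\<Sum>v\<in>V. n K v)) 0" for K
  have len: "length (l K) = K" for K
    using sum_n[of K] vs by (simp add: l_def length_concat comp_def sum_list_distinct_conv_sum_set)
  have sum_l: "sum_list (map \<phi> (l K)) = (\<Sum>v\<in>V. real (n K v) * \<phi> v) + (real K - (\<Sum>v\<in>V. real (n K v))) * \<phi> 0"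
    for K and \<phi> :: "real \<Rightarrow> real"
  proof -
    have "sum_list (map \<phi> (concat (map (\<lambda>v. replicate (n K v) v) us))) = (\<Sum>v\<leftarrow>us. real (n K v) * \<phi> v)" for us
      by (induction us) (simp_all add: sum_list_replicate)
    then show ?thesis
      using sum_n[of K] vs by (simp add: l_def sum_list_replicate sum_list_distinct_conv_sum_set of_nat_diff)
  qed
  show thesis
  proof (rule that[of "\<lambda>K r. l K ! r"])
    fix \<phi> :: "real \<Rightarrow> real"
    have "(\<lambda>K. (\<Sum>v\<in>V. real (n K v) / real K * \<phi> v) + (1 - (\<Sum>v\<in>V. real (n K v) / real K)) * \<phi> 0)
        \<longlonglongrightarrow> (\<Sum>v\<in>V. p v * \<phi> v) + (1 - (\<Sum>v\<in>V. p v)) * \<phi> 0"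
      by (intro tendsto_intros n_lim)
    then have lim: "(\<lambda>K. (\<Sum>v\<in>V. real (n K v) / real K * \<phi> v) + (1 - (\<Sum>v\<in>V. real (n K v) / real K)) * \<phi> 0)
        \<longlonglongrightarrow> (\<integral>x. \<phi> (s x) \<partial>M)" by (simp add: p1 int)
    show "(\<lambda>K. (\<Sum>r<K. \<phi> (l K ! r)) / real K) \<longlonglongrightarrow> (\<integral>x. \<phi> (s x) \<partial>M)"
    proof (rule Lim_transform_eventually[OF lim])
      show "\<forall>\<^sub>F K in sequentially. (\<Sum>v\<in>V. real (n K v) / real K * \<phi> v) + (1 - (\<Sum>v\<in>V. real (n K v) / real K)) * \<phi> 0
          = (\<Sum>r<K. \<phi> (l K ! r)) / real K"
        using eventually_gt_at_top[of 0]
      proof eventually_elim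
        case (elim K)
        have "(\<Sum>r<K. \<phi> (l K ! r)) = sum_list (map \<phi> (l K))"
          by (simp add: sum_list_sum_nth len atLeast0LessThan)
        then show ?case using elim
          by (simp add: sum_l add_divide_distrib diff_divide_distrib left_diff_distrib flip: sum_divide_distrib)
      qed
    qed
  qed
qed

text \<open>\<open>d\<close> is replaced by a simple function close in L1, and that by a finite
  list. As \<open>d\<close> has integral 0, the mean of the list is small, so subtracting it makes
  the sum exactly 0 at little cost to the test integrals.\<close>

lemma empirical_approximation:
  fixes d :: "'a \<Rightarrow> real"
  assumes d: "integrable M d" and d0: "(\<integral>x. d x \<partial>M) = 0"
    and \<Phi>: "finite \<Phi>" "\<And>\<phi>. \<phi> \<in> \<Phi> \<Longrightarrow> almost_lipschitz \<phi>" "\<And>\<phi>. \<phi> \<in> \<Phi> \<Longrightarrow> \<phi> \<in> borel_measurable borel"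
    and \<epsilon>: "\<epsilon> > 0"
  obtains K :: nat and a where "K \<ge> 1" "(\<Sum>r<K. a r) = 0"
    "\<And>\<phi>. \<phi> \<in> \<Phi> \<Longrightarrow> \<bar>(\<Sum>r<K. \<phi> (a r)) / real K - (\<integral>x. \<phi> (d x) \<partial>M)\<bar> < \<epsilon>"
proof -
  obtain C where C: "C \<ge> 0" "\<And>\<phi> x y. \<phi> \<in> \<Phi> \<Longrightarrow> \<bar>\<phi> x - \<phi> y\<bar> \<le> \<epsilon> / 6 + C * \<bar>x - y\<bar>"
    using almost_lipschitz_uniform[OF \<Phi>(1,2), of "\<epsilon> / 6"] \<epsilon> by auto
  \<comment> \<open>The budget is \<epsilon>/2 for centring the list, \<epsilon>/3 for passing from
    \<open>s\<close> to \<open>d\<close> and \<epsilon>/6 for the list itself. \<open>C + 1\<close>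
    avoids division by 0.\<close>
  define \<tau> where "\<tau> = \<epsilon> / (6 * (C + 1))"
  have \<tau>: "\<tau> > 0" using \<epsilon> C(1) by (simp add: \<tau>_def)
  have C\<tau>: "C * \<tau> \<le> \<epsilon> / 6" using \<epsilon> C(1) by (simp add: \<tau>_def field_simps)
  obtain s where s: "simple_function M s" "integrable M s" "L1_norm M (\<lambda>x. s x - d x) < \<tau>"
    using simple_function_L1_dense[OF d \<tau>] .
  obtain xs where xs: "\<And>\<phi> :: real \<Rightarrow> real. (\<lambda>K. (\<Sum>r<K. \<phi> (xs K r)) / real K) \<longlonglongrightarrow> (\<integral>x. \<phi> (s x) \<partial>M)"
    using simple_function_empirical[OF s(1)] by blast
  define m where "m K = (\<Sum>r<K. xs K r) / real K" for K
  have "\<bar>\<integral>x. s x \<partial>M\<bar> = \<bar>\<integral>x. s x - d x \<partial>M\<bar>" using s d d0 by simp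
  also have "\<dots> \<le> L1_norm M (\<lambda>x. s x - d x)" unfolding L1_norm_def by (rule integral_abs_bound)
  finally have "\<bar>\<integral>x. s x \<partial>M\<bar> < 2 * \<tau>" using s(3) \<tau> by linarith
  moreover have "(\<lambda>K. \<bar>m K\<bar>) \<longlonglongrightarrow> \<bar>\<integral>x. s x \<partial>M\<bar>"
    unfolding m_def by (intro tendsto_rabs xs[of "\<lambda>t. t"])
  ultimately have 1: "\<forall>\<^sub>F K in sequentially. \<bar>m K\<bar> < 2 * \<tau>" by (rule order_tendstoD(2)[rotated])
  have "\<forall>\<^sub>F K in sequentially. \<bar>(\<Sum>r<K. \<phi> (xs K r)) / real K - (\<integral>x. \<phi> (s x) \<partial>M)\<bar> < \<epsilon> / 6" for \<phi> :: "real \<Rightarrow> real"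
    using tendstoD[OF xs[of \<phi>], of "\<epsilon> / 6"] \<epsilon> by (simp add: dist_real_def)
  then have 2: "\<forall>\<^sub>F K in sequentially. \<forall>\<phi>\<in>\<Phi>. \<bar>(\<Sum>r<K. \<phi> (xs K r)) / real K - (\<integral>x. \<phi> (s x) \<partial>M)\<bar> < \<epsilon> / 6"
    using \<Phi>(1) by (simp add: eventually_ball_finite)
  from eventually_conj[OF eventually_conj[OF 1 2] eventually_ge_at_top[of 1]]
  obtain K where K: "\<bar>m K\<bar> < 2 * \<tau>" "K \<ge> 1"
    "\<And>\<phi>. \<phi> \<in> \<Phi> \<Longrightarrow> \<bar>(\<Sum>r<K. \<phi> (xs K r)) / real K - (\<integral>x. \<phi> (s x) \<partial>M)\<bar> < \<epsilon> / 6"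
    by (auto simp: eventually_sequentially)
  show thesis
  proof (rule that[of K "\<lambda>r. xs K r - m K"])
    show "K \<ge> 1" by (rule K)
    show "(\<Sum>r<K. xs K r - m K) = 0" using K(2) by (simp add: sum_subtractf m_def)
    fix \<phi> assume \<phi>: "\<phi> \<in> \<Phi>"
    have "\<bar>(\<Sum>r<K. \<phi> (xs K r - m K)) / real K - (\<Sum>r<K. \<phi> (xs K r)) / real K\<bar>
        = \<bar>\<Sum>r<K. \<phi> (xs K r - m K) - \<phi> (xs K r)\<bar> / real K"
      using K(2) by (simp add: sum_subtractf flip: diff_divide_distrib)
    also have "\<dots> \<le> (\<Sum>r<K. \<bar>\<phi> (xs K r - m K) - \<phi> (xs K r)\<bar>) / real K"
      by (intro divide_right_mono sum_abs) auto
    also have "\<dots> \<le> (\<Sum>r<K. \<epsilon> / 6 + C * (2 * \<tau>)) / real K"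
    proof (intro divide_right_mono sum_mono)
      fix r
      have "\<bar>\<phi> (xs K r - m K) - \<phi> (xs K r)\<bar> \<le> \<epsilon> / 6 + C * \<bar>m K\<bar>"
        using C(2)[OF \<phi>, of "xs K r - m K" "xs K r"] by simp
      also have "C * \<bar>m K\<bar> \<le> C * (2 * \<tau>)" using K(1) C(1) by (intro mult_left_mono) auto
      finally show "\<bar>\<phi> (xs K r - m K) - \<phi> (xs K r)\<bar> \<le> \<epsilon> / 6 + C * (2 * \<tau>)" by simp
    qed auto
    also have "\<dots> \<le> \<epsilon> / 2" using K(2) C\<tau> by simp
    finally have "\<bar>(\<Sum>r<K. \<phi> (xs K r - m K)) / real K - (\<Sum>r<K. \<phi> (xs K r)) / real K\<bar> \<le> \<epsilon> / 2" .
    moreover have "\<bar>(\<integral>x. \<phi> (s x) \<partial>M) - (\<integral>x. \<phi> (d x) \<partial>M)\<bar> \<le> \<epsilon> / 6 + C * L1_norm M (\<lambda>x. s x - d x)"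
      using \<Phi>(2,3)[OF \<phi>]
      by (intro integral_almost_lipschitz_diff_le[OF s(2) d _ _ C(2)[OF \<phi>]]
          integrable_almost_lipschitz[OF s(2)] integrable_almost_lipschitz[OF d])
    moreover have "C * L1_norm M (\<lambda>x. s x - d x) \<le> C * \<tau>"
      using s(3) C(1) by (intro mult_left_mono) auto
    ultimately show "\<bar>(\<Sum>r<K. \<phi> (xs K r - m K)) / real K - (\<integral>x. \<phi> (d x) \<partial>M)\<bar> < \<epsilon>"
      using K(3)[OF \<phi>] C\<tau> by linarith
  qed
qed

text \<open>Monotone convergence shows that the series converges absolutely almost everywhere. The
  third claim bounds the remainder by the norms of the omitted terms, which later measures how
  little the late terms matter.\<close>

lemma L1_series:
  fixes u :: "nat \<Rightarrow> 'a \<Rightarrow> real"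
  assumes u: "\<And>i. integrable M (u i)" and sm: "summable (\<lambda>i. L1_norm M (u i))"
  shows "integrable M (\<lambda>x. \<Sum>i. u i x)"
    and "(\<lambda>i. \<integral>x. u i x \<partial>M) sums (\<integral>x. (\<Sum>i. u i x) \<partial>M)"
    and "L1_norm M (\<lambda>x. (\<Sum>i. u i x) - (\<Sum>i<n. u i x)) \<le> (\<Sum>i. L1_norm M (u (i + n)))"
proof -
  have [measurable]: "u i \<in> borel_measurable M" for i using u by auto
  have ae: "AE x in M. summable (\<lambda>i. \<bar>u i x\<bar>)"
  proof -
    have "(\<integral>\<^sup>+x. (\<Sum>i. ennreal \<bar>u i x\<bar>) \<partial>M) = (\<Sum>i. \<integral>\<^sup>+x. ennreal \<bar>u i x\<bar> \<partial>M)"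
      by (rule nn_integral_suminf) measurable
    also have "\<dots> = (\<Sum>i. ennreal (L1_norm M (u i)))"
      unfolding L1_norm_def using u by (intro suminf_cong nn_integral_eq_integral) auto
    also have "\<dots> = ennreal (\<Sum>i. L1_norm M (u i))"
      using sm by (intro suminf_ennreal2 L1_norm_nonneg)
    finally have "(\<integral>\<^sup>+x. (\<Sum>i. ennreal \<bar>u i x\<bar>) \<partial>M) \<noteq> \<infinity>" by simp
    then have "AE x in M. (\<Sum>i. ennreal \<bar>u i x\<bar>) \<noteq> \<infinity>"
      by (intro nn_integral_noteq_infinite) auto
    then show ?thesis
      by eventually_elim (auto intro!: summable_suminf_not_top)
  qed
  have sm': "summable (\<lambda>i. \<integral>x. norm (u i x) \<partial>M)" using sm by (simp add: L1_norm_def)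
  have ae': "AE x in M. summable (\<lambda>i. norm (u i x))" using ae by simp
  show I: "integrable M (\<lambda>x. \<Sum>i. u i x)" by (rule integrable_suminf[OF u ae' sm'])
  show "(\<lambda>i. \<integral>x. u i x \<partial>M) sums (\<integral>x. (\<Sum>i. u i x) \<partial>M)" by (rule sums_integral[OF u ae' sm'])
  let ?v = "\<lambda>i x. \<bar>u (i + n) x\<bar>"
  have v: "integrable M (?v i)" for i using u by auto
  have v_ae: "AE x in M. summable (\<lambda>i. norm (?v i x))"
    using ae by eventually_elim (simp add: summable_iff_shift[of "\<lambda>i. \<bar>u i _\<bar>"])
  have v_sm: "summable (\<lambda>i. \<integral>x. norm (?v i x) \<partial>M)"
    using sm by (simp add: L1_norm_def summable_iff_shift[of "\<lambda>i. \<integral>x. \<bar>u i x\<bar> \<partial>M"])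
  have "L1_norm M (\<lambda>x. (\<Sum>i. u i x) - (\<Sum>i<n. u i x)) \<le> (\<integral>x. (\<Sum>i. ?v i x) \<partial>M)"
    unfolding L1_norm_def
  proof (rule integral_mono_AE)
    show "integrable M (\<lambda>x. \<bar>(\<Sum>i. u i x) - (\<Sum>i<n. u i x)\<bar>)" using I u by auto
    show "integrable M (\<lambda>x. \<Sum>i. ?v i x)" by (rule integrable_suminf[OF v v_ae v_sm])
    show "AE x in M. \<bar>(\<Sum>i. u i x) - (\<Sum>i<n. u i x)\<bar> \<le> (\<Sum>i. ?v i x)"
      using ae
    proof eventually_elim
      case (elim x)
      then have "summable (\<lambda>i. u i x)" by (rule summable_rabs_cancel)
      then have "(\<Sum>i. u i x) - (\<Sum>i<n. u i x) = (\<Sum>i. u (i + n) x)"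
        by (rule suminf_minus_initial_segment[symmetric])
      moreover have "summable (\<lambda>i. ?v i x)" using elim by (simp add: summable_iff_shift[of "\<lambda>i. \<bar>u i x\<bar>"])
      ultimately show ?case by (simp add: summable_rabs)
    qed
  qed
  also have "\<dots> = (\<Sum>i. L1_norm M (u (i + n)))"
    unfolding L1_norm_def by (rule integral_suminf[OF v v_ae v_sm])
  finally show "L1_norm M (\<lambda>x. (\<Sum>i. u i x) - (\<Sum>i<n. u i x)) \<le> (\<Sum>i. L1_norm M (u (i + n)))" .
qed

end

text \<open>A basic open set of the product topology restricts only finitely many coordinates
  \<phi>, and at each it contains a ball around the integral of \<phi>.\<close>

lemma weak_star_nbhd_basic:
  assumes "weak_star_nbhd V \<nu>"
  obtains \<Phi> \<eta> where "finite \<Phi>" "\<Phi> \<subseteq> C0" "\<eta> > 0"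
    "\<And>\<nu>'. prob_space \<nu>' \<Longrightarrow> sets \<nu>' = sets borel \<Longrightarrow>
      (\<And>\<phi>. \<phi> \<in> \<Phi> \<Longrightarrow> \<bar>(\<integral>t. \<phi> t \<partial>\<nu>') - (\<integral>t. \<phi> t \<partial>\<nu>)\<bar> < \<eta>) \<Longrightarrow> C0_functional \<nu>' \<in> V"
proof -
  obtain W where W: "openin (product_topology (\<lambda>_. euclideanreal) C0) W"
    "C0_functional \<nu> \<in> W" "W \<inter> C0_dual \<subseteq> V"
    using assms unfolding weak_star_nbhd_def weak_star_def openin_subtopology by auto
  then obtain B where B: "finite {\<phi> \<in> C0. B \<phi> \<noteq> UNIV}" "\<And>\<phi>. \<phi> \<in> C0 \<Longrightarrow> open (B \<phi>)"
    "C0_functional \<nu> \<in> Pi\<^sub>E C0 B" "Pi\<^sub>E C0 B \<subseteq> W"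
    unfolding openin_product_topology_alt by auto
  define \<Phi> where "\<Phi> = {\<phi> \<in> C0. B \<phi> \<noteq> UNIV}"
  have "\<exists>e>0. ball (\<integral>t. \<phi> t \<partial>\<nu>) e \<subseteq> B \<phi>" if "\<phi> \<in> \<Phi>" for \<phi>
  proof -
    have "\<phi> \<in> C0" using that by (simp add: \<Phi>_def)
    moreover from this have "(\<integral>t. \<phi> t \<partial>\<nu>) \<in> B \<phi>" using B(3) by (auto simp: C0_functional_def PiE_def Pi_def)
    ultimately show ?thesis using B(2) open_contains_ball by blast
  qed
  then obtain e where e: "\<And>\<phi>. \<phi> \<in> \<Phi> \<Longrightarrow> e \<phi> > 0" "\<And>\<phi>. \<phi> \<in> \<Phi> \<Longrightarrow> ball (\<integral>t. \<phi> t \<partial>\<nu>) (e \<phi>) \<subseteq> B \<phi>"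
    by metis
  \<comment> \<open>The extra element 1 makes the minimum meaningful when no coordinate is
    restricted.\<close>
  define \<eta> where "\<eta> = Min (insert 1 (e ` \<Phi>))"
  have fin: "finite \<Phi>" using B(1) by (simp add: \<Phi>_def)
  show thesis
  proof (rule that[of \<Phi> \<eta>])
    show "finite \<Phi>" by (rule fin)
    show "\<Phi> \<subseteq> C0" by (auto simp: \<Phi>_def)
    show "\<eta> > 0" using fin e(1) by (simp add: \<eta>_def)
    fix \<nu>' assume \<nu>': "prob_space \<nu>'" "sets \<nu>' = sets (borel :: real measure)"
      and close: "\<And>\<phi>. \<phi> \<in> \<Phi> \<Longrightarrow> \<bar>(\<integral>t. \<phi> t \<partial>\<nu>') - (\<integral>t. \<phi> t \<partial>\<nu>)\<bar> < \<eta>"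
    have "C0_functional \<nu>' \<in> Pi\<^sub>E C0 B"
    proof (rule PiE_I)
      fix \<phi> assume \<phi>: "\<phi> \<in> C0"
      show "C0_functional \<nu>' \<phi> \<in> B \<phi>"
      proof (cases "\<phi> \<in> \<Phi>")
        case True
        then have "\<eta> \<le> e \<phi>" using fin by (simp add: \<eta>_def)
        with close[OF True] have "(\<integral>t. \<phi> t \<partial>\<nu>') \<in> ball (\<integral>t. \<phi> t \<partial>\<nu>) (e \<phi>)"
          by (simp add: dist_real_def abs_minus_commute)
        with e(2)[OF True] \<phi> show ?thesis by (auto simp: C0_functional_def)
      next
        case False
        then show ?thesis using \<phi> by (simp add: \<Phi>_def)
      qed
    qed (simp add: C0_functional_def)
    with B(4) W(3) C0_functional_in_dual[OF \<nu>'] show "C0_functional \<nu>' \<in> V" by blast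
  qed
qed

section \<open>The series\<close>

context prob_space
begin

text \<open>Including \<open>abs\<close> among the test functions forces the norm of
  \<open>h\<close>, hence that of \<open>g\<close>, to be close to 1. Normalizing then moves
  \<open>g\<close> by less than 2\<delta>, so the normalized function stays within 3\<delta> of
  \<open>h\<close>.\<close>

lemma normalized_distribution_mem:
  assumes d: "integrable M d" "L1_norm M d = 1" and V: "weak_star_nbhd V (distribution M d)"
  obtains \<Phi> \<delta> where "finite \<Phi>" "\<Phi> \<subseteq> C0" "0 < \<delta>" "\<delta> \<le> 1"
    "\<And>g h. integrable M g \<Longrightarrow> integrable M h \<Longrightarrow>
      (\<And>\<phi>. \<phi> \<in> insert abs \<Phi> \<Longrightarrow> \<bar>(\<integral>x. \<phi> (h x) \<partial>M) - (\<integral>x. \<phi> (d x) \<partial>M)\<bar> < \<delta>) \<Longrightarrow>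
      L1_norm M (\<lambda>x. g x - h x) < \<delta> \<Longrightarrow>
      L1_norm M g > 0 \<and> C0_functional (distribution M (\<lambda>x. g x / L1_norm M g)) \<in> V"
proof -
  obtain \<Phi> \<eta> where \<Phi>: "finite \<Phi>" "\<Phi> \<subseteq> C0" and \<eta>: "\<eta> > 0"
    and V_mem: "\<And>\<nu>'. prob_space \<nu>' \<Longrightarrow> sets \<nu>' = sets borel \<Longrightarrow>
      (\<And>\<phi>. \<phi> \<in> \<Phi> \<Longrightarrow> \<bar>(\<integral>t. \<phi> t \<partial>\<nu>') - (\<integral>t. \<phi> t \<partial>distribution M d)\<bar> < \<eta>) \<Longrightarrow> C0_functional \<nu>' \<in> V"
    using weak_star_nbhd_basic[OF V] by blast
  have meas: "\<phi> \<in> borel_measurable borel" if "\<phi> \<in> \<Phi>" for \<phi>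
    using \<Phi>(2) that by (intro borel_measurable_continuous_onI) (auto simp: C0_def)
  have lip: "almost_lipschitz \<phi>" if "\<phi> \<in> \<Phi>" for \<phi>
    using \<Phi>(2) that almost_lipschitz_C0 by blast
  obtain C where C: "C \<ge> 0" "\<And>\<phi> x y. \<phi> \<in> \<Phi> \<Longrightarrow> \<bar>\<phi> x - \<phi> y\<bar> \<le> \<eta> / 4 + C * \<bar>x - y\<bar>"
    using almost_lipschitz_uniform[OF \<Phi>(1) lip, of "\<eta> / 4"] \<eta> by auto
  \<comment> \<open>The bound 1/4 keeps the norm of \<open>g\<close> positive; the other two make
    \<eta>/4 + 3C\<delta> + \<delta> less than \<eta>.\<close>
  define \<delta> where "\<delta> = min (1 / 4) (min (\<eta> / 4) (\<eta> / (16 * (C + 1))))"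
  have \<delta>: "0 < \<delta>" using \<eta> C(1) by (simp add: \<delta>_def)
  have \<delta>_le: "\<delta> \<le> 1 / 4" "\<delta> \<le> \<eta> / 4" unfolding \<delta>_def by linarith+
  have "\<delta> \<le> \<eta> / (16 * (C + 1))" by (simp add: \<delta>_def)
  then have "(C + 1) * \<delta> \<le> \<eta> / 16" using C(1) by (simp add: field_simps)
  then have C\<delta>: "C * \<delta> \<le> \<eta> / 16" using \<delta> by (simp add: algebra_simps)
  show thesis
  proof (rule that[OF \<Phi> \<delta>])
    show "\<delta> \<le> 1" using \<delta>_le(1) by simp
    fix g h assume g: "integrable M g" and h: "integrable M h"
      and hd: "\<And>\<phi>. \<phi> \<in> insert abs \<Phi> \<Longrightarrow> \<bar>(\<integral>x. \<phi> (h x) \<partial>M) - (\<integral>x. \<phi> (d x) \<partial>M)\<bar> < \<delta>"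
      and gh: "L1_norm M (\<lambda>x. g x - h x) < \<delta>"
    define c where "c = L1_norm M g"
    have "\<bar>L1_norm M h - 1\<bar> < \<delta>" using hd[of abs] d(2) by (simp add: L1_norm_def)
    moreover have "c \<le> L1_norm M h + L1_norm M (\<lambda>x. g x - h x)"
      using L1_norm_add_le[OF h Bochner_Integration.integrable_diff[OF g h]] by (simp add: c_def)
    moreover have "L1_norm M h \<le> c + L1_norm M (\<lambda>x. g x - h x)"
      using L1_norm_diff_le[OF g Bochner_Integration.integrable_diff[OF g h]] by (simp add: c_def)
    ultimately have c: "\<bar>c - 1\<bar> < 2 * \<delta>" using gh by linarith
    then have c0: "c > 0" using \<delta>_le(1) by linarith
    let ?G = "\<lambda>x. g x / c"
    have G: "integrable M ?G" using g by simp
    have "L1_norm M (\<lambda>x. ?G x - g x) = L1_norm M (\<lambda>x. (1 / c - 1) * g x)"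
      by (rule L1_norm_cong) (simp add: algebra_simps)
    also have "\<dots> = \<bar>1 / c - 1\<bar> * c" by (simp add: L1_norm_scale c_def)
    also have "\<dots> = \<bar>(1 / c - 1) * c\<bar>" using c0 by (simp add: abs_mult)
    also have "(1 / c - 1) * c = 1 - c" using c0 by (simp add: left_diff_distrib)
    finally have "L1_norm M (\<lambda>x. ?G x - g x) < 2 * \<delta>" using c by linarith
    moreover have "L1_norm M (\<lambda>x. ?G x - h x) \<le> L1_norm M (\<lambda>x. ?G x - g x) + L1_norm M (\<lambda>x. g x - h x)"
      using L1_norm_add_le[OF Bochner_Integration.integrable_diff[OF G g] Bochner_Integration.integrable_diff[OF g h]]
      by simp
    ultimately have Gh: "L1_norm M (\<lambda>x. ?G x - h x) \<le> 3 * \<delta>" using gh by linarith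
    have "C0_functional (distribution M ?G) \<in> V"
    proof (rule V_mem)
      show "prob_space (distribution M ?G)"
        unfolding distribution_def using G by (intro prob_space_distr) auto
      show "sets (distribution M ?G) = sets borel" by (simp add: distribution_def)
      fix \<phi> assume \<phi>: "\<phi> \<in> \<Phi>"
      note [measurable] = meas[OF \<phi>] and i = integrable_almost_lipschitz[OF _ lip[OF \<phi>] meas[OF \<phi>]]
      have "\<bar>(\<integral>x. \<phi> (?G x) \<partial>M) - (\<integral>x. \<phi> (h x) \<partial>M)\<bar> \<le> \<eta> / 4 + C * L1_norm M (\<lambda>x. ?G x - h x)"
        by (rule integral_almost_lipschitz_diff_le[OF G h i[OF G] i[OF h] C(2)[OF \<phi>]])
      also have "C * L1_norm M (\<lambda>x. ?G x - h x) \<le> C * (3 * \<delta>)"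
        using Gh C(1) by (rule mult_left_mono)
      finally have "\<bar>(\<integral>x. \<phi> (?G x) \<partial>M) - (\<integral>x. \<phi> (d x) \<partial>M)\<bar> < \<eta>"
        using hd[of \<phi>] \<phi> C\<delta> \<delta>_le(2) \<eta> by auto
      moreover have "(\<integral>t. \<phi> t \<partial>distribution M k) = (\<integral>x. \<phi> (k x) \<partial>M)" if "integrable M k" for k
        unfolding distribution_def using that by (intro integral_distr) auto
      ultimately show "\<bar>(\<integral>t. \<phi> t \<partial>distribution M ?G) - (\<integral>t. \<phi> t \<partial>distribution M d)\<bar> < \<eta>"
        using G d(1) by simp
    qed
    with c0 show "L1_norm M g > 0 \<and> C0_functional (distribution M (\<lambda>x. g x / L1_norm M g)) \<in> V"
      by (simp add: c_def)
  qed
qed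

end

section \<open>Building blocks and the choice of scales\<close>

context lattice_action
begin

lemma L1_norm_average_diff_le:
  assumes h: "integrable M h" and N: "N \<ge> 1"
    and \<epsilon>: "\<And>w. w \<in> cube N \<Longrightarrow> L1_norm M (\<lambda>x. h (T w x) - h x) \<le> \<epsilon>"
  shows "L1_norm M (\<lambda>x. average T N h x - h x) \<le> \<epsilon>"
proof -
  let ?c = "1 / real N ^ CARD('d)"
  have "average T N h x - h x = ?c * (\<Sum>z\<in>cube N. h (T z x) - h x)" for x
    using N by (simp add: average_def sum_subtractf card_cube diff_divide_distrib)
  then have "L1_norm M (\<lambda>x. average T N h x - h x) = ?c * L1_norm M (\<lambda>x. \<Sum>z\<in>cube N. h (T z x) - h x)"
    using L1_norm_scale[of M ?c "\<lambda>x. \<Sum>z\<in>cube N. h (T z x) - h x"] by simp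
  also have "\<dots> \<le> ?c * (\<Sum>z\<in>(cube N :: (int ^ 'd) set). L1_norm M (\<lambda>x. h (T z x) - h x))"
    by (intro mult_left_mono L1_norm_sum_le Bochner_Integration.integrable_diff integrable_T h) auto
  also have "\<dots> \<le> ?c * (\<Sum>z\<in>(cube N :: (int ^ 'd) set). \<epsilon>)"
    by (intro mult_left_mono sum_mono \<epsilon>) auto
  also have "\<dots> = \<epsilon>" using N by (simp add: card_cube)
  finally show ?thesis .
qed

text \<open>The last clause turns membership in \<open>V\<close> into an L1 estimate, so that the
  series argument needs only norms.\<close>

definition building_block :: "(int ^ 'd) set \<Rightarrow> real \<Rightarrow> ((real \<Rightarrow> real) \<Rightarrow> real) set \<Rightarrow> ('a \<Rightarrow> real) \<Rightarrow> bool" where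
  "building_block F \<delta> V h \<longleftrightarrow>
     integrable M h \<and> (\<integral>x. h x \<partial>M) = 0 \<and> L1_norm M h \<le> 2 \<and>
     (\<forall>w\<in>F. L1_norm M (\<lambda>x. h (T w x) - h x) \<le> \<delta> / 4) \<and>
     (\<lambda>N. L1_norm M (average T N h)) \<longlonglongrightarrow> 0 \<and>
     (\<forall>g. integrable M g \<longrightarrow> L1_norm M (\<lambda>x. g x - h x) < \<delta> \<longrightarrow>
       L1_norm M g > 0 \<and> C0_functional (distribution M (\<lambda>x. g x / L1_norm M g)) \<in> V)"

text \<open>The order of quantifiers matters: \<delta> depends only on \<open>d\<close> and
  \<open>V\<close>, so all coefficients of the series can be fixed first, whereas \<open>F\<close>
  is a cube whose side is chosen after the earlier blocks.\<close>

lemma building_block_exists: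
  assumes M: "lebesgue_prob_space M" "free_action M T"
    and d: "integrable M d" "L1_norm M d = 1" "(\<integral>x. d x \<partial>M) = 0"
    and V: "weak_star_nbhd V (distribution M d)"
  shows "\<exists>\<delta>>0. \<delta> \<le> 1 \<and> (\<forall>F. finite F \<longrightarrow> (\<exists>h. building_block F \<delta> V h))"
proof -
  from separating_function[OF M] obtain U :: "'a \<Rightarrow> real" and X where
    U: "U \<in> borel_measurable M" and X: "X \<in> sets M" "measure M X = 1"
    and sep': "\<forall>x\<in>X. \<forall>w. w \<noteq> 0 \<longrightarrow> U (T w x) \<noteq> U x"
    by (elim bexE conjE)
  have sep: "U (T w x) \<noteq> U x" if "x \<in> X" "w \<noteq> 0" for x w
    using sep' that by simp
  obtain \<Phi> \<delta> where \<Phi>: "finite \<Phi>" "\<Phi> \<subseteq> C0" and \<delta>: "0 < \<delta>" "\<delta> \<le> 1"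
    and mem: "\<And>g h. integrable M g \<Longrightarrow> integrable M h \<Longrightarrow>
      (\<And>\<phi>. \<phi> \<in> insert abs \<Phi> \<Longrightarrow> \<bar>(\<integral>x. \<phi> (h x) \<partial>M) - (\<integral>x. \<phi> (d x) \<partial>M)\<bar> < \<delta>) \<Longrightarrow>
      L1_norm M (\<lambda>x. g x - h x) < \<delta> \<Longrightarrow>
      L1_norm M g > 0 \<and> C0_functional (distribution M (\<lambda>x. g x / L1_norm M g)) \<in> V"
    using normalized_distribution_mem[OF d(1,2) V] by blast
  let ?\<Phi> = "insert abs \<Phi>"
  have fin: "finite ?\<Phi>" using \<Phi>(1) by simp
  have meas: "\<phi> \<in> borel_measurable borel" if "\<phi> \<in> ?\<Phi>" for \<phi>
    using \<Phi>(2) that by (intro borel_measurable_continuous_onI) (auto simp: C0_def intro: continuous_intros)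
  have lip: "almost_lipschitz \<phi>" if "\<phi> \<in> ?\<Phi>" for \<phi>
    using \<Phi>(2) that almost_lipschitz_C0 almost_lipschitz_abs by blast
  obtain K a where K: "K \<ge> 1" and a: "(\<Sum>r<K. a r) = 0"
    and a\<Phi>: "\<And>\<phi>. \<phi> \<in> ?\<Phi> \<Longrightarrow> \<bar>(\<Sum>r<K. \<phi> (a r)) / real K - (\<integral>x. \<phi> (d x) \<partial>M)\<bar> < \<delta> / 2"
    using empirical_approximation[OF d(1,3) fin lip meas, of "\<delta> / 2"] \<delta>(1) by auto
  \<comment> \<open>Subtracting \<open>\<phi> 0\<close> meets the normalization in
    \<open>partial_copy\<close>. The uncovered part then costs its measure times
    \<open>\<bar>m \<phi>\<bar>\<close>, which \<open>S\<close> bounds for all test functions at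
    once.\<close>
  define m where "m \<phi> = (\<Sum>r<K. \<phi> (a r) - \<phi> 0) / real K" for \<phi> :: "real \<Rightarrow> real"
  define S where "S = (\<Sum>\<phi>\<in>?\<Phi>. \<bar>m \<phi>\<bar>)"
  have S: "S \<ge> 0" "\<And>\<phi>. \<phi> \<in> ?\<Phi> \<Longrightarrow> \<bar>m \<phi>\<bar> \<le> S"
    unfolding S_def using fin by (auto intro: sum_nonneg member_le_sum simp del: sum.insert_remove)
  have "\<exists>h. building_block F \<delta> V h" if F: "finite F" for F
  proof -
    have "\<delta> / 4 > 0" "\<delta> / (2 * (S + 1)) > 0" using \<delta>(1) S(1) by auto
    from partial_copy_exhaustion[OF U X sep K a F this] obtain E h where
      Eh: "partial_copy K a F (\<delta> / 4) E h" and E: "1 - measure M E \<le> \<delta> / (2 * (S + 1))" by blast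
    have h: "integrable M h" by (rule partial_copy_integrable[OF Eh])
    have close: "\<bar>(\<integral>x. \<phi> (h x) \<partial>M) - (\<integral>x. \<phi> (d x) \<partial>M)\<bar> < \<delta>" if \<phi>: "\<phi> \<in> ?\<Phi>" for \<phi>
    proof -
      have i: "integrable M (\<lambda>x. \<phi> (h x))" by (rule integrable_almost_lipschitz[OF h lip[OF \<phi>] meas[OF \<phi>]])
      have "(\<integral>x. \<phi> (h x) - \<phi> 0 \<partial>M) = measure M E * m \<phi>"
        unfolding m_def using meas[OF \<phi>] by (intro partial_copyD(5)[OF Eh, of "\<lambda>t. \<phi> t - \<phi> 0"]) auto
      then have "(\<integral>x. \<phi> (h x) \<partial>M) = \<phi> 0 + measure M E * m \<phi>" using i by (simp add: prob_space)
      moreover have "(\<Sum>r<K. \<phi> (a r)) / real K = \<phi> 0 + m \<phi>"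
        using K by (simp add: m_def sum_subtractf diff_divide_distrib)
      ultimately have "\<bar>(\<integral>x. \<phi> (h x) \<partial>M) - (\<Sum>r<K. \<phi> (a r)) / real K\<bar> = \<bar>(measure M E - 1) * m \<phi>\<bar>"
        by (simp add: algebra_simps)
      also have "\<dots> = (1 - measure M E) * \<bar>m \<phi>\<bar>" by (simp add: abs_mult)
      also have "\<dots> \<le> \<delta> / (2 * (S + 1)) * S"
        using E S \<phi> \<delta>(1) by (intro mult_mono) auto
      also have "\<dots> \<le> \<delta> / 2" using S(1) \<delta>(1) by (simp add: field_simps)
      finally show ?thesis using a\<Phi>[OF \<phi>] by linarith
    qed
    have "building_block F \<delta> V h"
      unfolding building_block_def
    proof (intro conjI allI impI ballI)
      show "integrable M h" by (rule h)
      show "(\<integral>x. h x \<partial>M) = 0" using partial_copyD(5)[OF Eh, of "\<lambda>t. t"] a by simp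
      show "L1_norm M h \<le> 2" using close[of abs] d(2) \<delta>(2) by (simp add: L1_norm_def)
      show "L1_norm M (\<lambda>x. h (T w x) - h x) \<le> \<delta> / 4" if "w \<in> F" for w
        by (rule partial_copyD(7)[OF Eh that])
      show "(\<lambda>N. L1_norm M (average T N h)) \<longlonglongrightarrow> 0" by (rule partial_copyD(8)[OF Eh])
      fix g assume g: "integrable M g" "L1_norm M (\<lambda>x. g x - h x) < \<delta>"
      note * = mem[OF g(1) h close g(2)]
      show "L1_norm M g > 0" "C0_functional (distribution M (\<lambda>x. g x / L1_norm M g)) \<in> V"
        using * by blast+
    qed
    then show ?thesis by blast
  qed
  with \<delta> show ?thesis by blast
qed

text \<open>Divided by \<open>\<alpha> j\<close>, the average of \<open>f\<close> at scale
  \<open>N j\<close> differs from \<open>h j\<close> by three errors of at most \<delta>/4: earlier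
  terms are averaged out, \<open>h j\<close> is almost invariant under the cube, and later terms
  have small norm, which averaging does not increase.\<close>

lemma averages_with_prescribed_distributions:
  fixes \<delta> :: "nat \<Rightarrow> real" and V :: "nat \<Rightarrow> ((real \<Rightarrow> real) \<Rightarrow> real) set" and growth :: "nat \<Rightarrow> nat"
  assumes \<delta>: "\<And>j. 0 < \<delta> j" "\<And>j. \<delta> j \<le> 1"
    and blocks: "\<forall>j F. finite F \<longrightarrow> (\<exists>h. building_block F (\<delta> j) (V j) h)"
  shows "\<exists>f N. integrable M f \<and> (\<integral>x. f x \<partial>M) = 0 \<and>
    (\<forall>j. 1 \<le> N j \<and> N j < N (Suc j) \<and> growth (N j) \<le> N (Suc j) \<and>
       L1_norm M (average T (N j) f) > 0 \<and>
       C0_functional (distribution M (\<lambda>x. average T (N j) f x / L1_norm M (average T (N j) f))) \<in> V j)"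
proof -
  \<comment> \<open>The factor 1/16 suffices: blocks have norm at most 2, so the terms after
    \<open>j\<close> sum to at most (\<alpha> \<delta> / 8)(16/15), below \<alpha> \<delta> /
    4.\<close>
  define \<alpha> where "\<alpha> j = (\<Prod>i<j. \<delta> i / 16)" for j
  have \<alpha>_pos: "0 < \<alpha> j" for j unfolding \<alpha>_def using \<delta>(1) by (intro prod_pos) auto
  have \<alpha>_Suc: "\<alpha> (Suc j) = \<alpha> j * (\<delta> j / 16)" for j by (simp add: \<alpha>_def)
  have \<alpha>_decay: "\<alpha> (i + Suc j) \<le> \<alpha> j * \<delta> j / 16 * (1 / 16) ^ i" for i j
  proof (induction i)
    case (Suc i)
    have "\<alpha> (Suc i + Suc j) = \<alpha> (i + Suc j) * (\<delta> (i + Suc j) / 16)" using \<alpha>_Suc[of "i + Suc j"] by simp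
    also have "\<dots> \<le> (\<alpha> j * \<delta> j / 16 * (1 / 16) ^ i) * (1 / 16)"
      using \<alpha>_pos \<delta> less_imp_le[OF \<alpha>_pos] less_imp_le[OF \<delta>(1)]
      by (intro mult_mono Suc.IH divide_right_mono) auto
    finally show ?case by simp
  qed (simp add: \<alpha>_Suc)
  \<comment> \<open>A state consists of a scale, the block for it and the sum \<open>s\<close> of
    all earlier terms. The next scale depends on the current block through \<open>s'\<close>, and
    the next block on that scale, so the sequence is obtained by dependent choice.\<close>
  define P where "P j = (\<lambda>(N, h, s). 1 \<le> N \<and> building_block (cube N) (\<delta> j) (V j) h \<and> integrable M s \<and>
      (\<lambda>N. L1_norm M (average T N s)) \<longlonglongrightarrow> 0 \<and> L1_norm M (average T N s) \<le> \<alpha> j * \<delta> j / 4 \<and>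
      (j = 0 \<longrightarrow> s = (\<lambda>_. 0)))" for j
  define Q where "Q j = (\<lambda>(N, h, s :: 'a \<Rightarrow> real) (N', h' :: 'a \<Rightarrow> real, s').
      s' = (\<lambda>x. s x + \<alpha> j * h x) \<and> N < N' \<and> growth N \<le> N')" for j
  have "\<exists>y. \<forall>j. P j (y j) \<and> Q j (y j) (y (Suc j))"
  proof (rule dependent_nat_choice)
    obtain h where "building_block (cube 1) (\<delta> 0) (V 0) h" using blocks finite_cube by blast
    then have "P 0 (1, h, \<lambda>_. 0)"
      using \<delta>(1)[of 0] \<alpha>_pos[of 0] by (simp add: P_def L1_norm_def average_def)
    then show "\<exists>y. P 0 y" by blast
  next
    fix y j assume y: "P j y"
    obtain N h s where [simp]: "y = (N, h, s)" by (cases y)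
    have h: "integrable M h" "(\<lambda>N. L1_norm M (average T N h)) \<longlonglongrightarrow> 0"
      and s: "integrable M s" "(\<lambda>N. L1_norm M (average T N s)) \<longlonglongrightarrow> 0"
      using y by (simp_all add: P_def building_block_def)
    define s' where "s' = (\<lambda>x. s x + \<alpha> j * h x)"
    have s': "integrable M s'" unfolding s'_def using s h by auto
    have "L1_norm M (average T N s') \<le> L1_norm M (average T N s) + \<alpha> j * L1_norm M (average T N h)" for N
      using L1_norm_add_le[OF integrable_average[OF s(1)] integrable_mult_right[OF integrable_average[OF h(1)]], of N "\<alpha> j" N]
        \<alpha>_pos[of j] by (simp add: s'_def average_add[abs_def] average_scale[abs_def] L1_norm_scale)
    moreover have lim: "(\<lambda>N. L1_norm M (average T N s) + \<alpha> j * L1_norm M (average T N h)) \<longlonglongrightarrow> 0"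
      using tendsto_add[OF s(2) tendsto_mult_left[OF h(2), of "\<alpha> j"]] by simp
    ultimately have s'_lim: "(\<lambda>N. L1_norm M (average T N s')) \<longlonglongrightarrow> 0"
      by (intro tendsto_sandwich[OF _ _ tendsto_const lim]) (simp_all add: L1_norm_nonneg)
    have "0 < \<alpha> (Suc j) * \<delta> (Suc j) / 4" using \<alpha>_pos \<delta>(1) by simp
    from order_tendstoD(2)[OF s'_lim this]
    obtain N0 where N0: "\<And>N. N \<ge> N0 \<Longrightarrow> L1_norm M (average T N s') < \<alpha> (Suc j) * \<delta> (Suc j) / 4"
      by (auto simp: eventually_sequentially)
    \<comment> \<open>\<open>N0\<close> makes the earlier terms negligible, \<open>Suc N\<close>
      gives strict growth, and \<open>growth N\<close> imposes the prescribed rate.\<close>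
    define N' where "N' = max N0 (max (Suc N) (growth N))"
    obtain h' where "building_block (cube N') (\<delta> (Suc j)) (V (Suc j)) h'" using blocks finite_cube by blast
    moreover have "L1_norm M (average T N' s') \<le> \<alpha> (Suc j) * \<delta> (Suc j) / 4"
      using N0[of N'] by (simp add: N'_def)
    ultimately have "P (Suc j) (N', h', s')" using s' s'_lim by (simp add: P_def N'_def)
    moreover have "N < N'" "growth N \<le> N'" unfolding N'_def by linarith+
    then have "Q j y (N', h', s')" by (simp add: Q_def s'_def)
    ultimately show "\<exists>y'. P (Suc j) y' \<and> Q j y y'" by blast
  qed
  then obtain y where y: "\<And>j. P j (y j)" "\<And>j. Q j (y j) (y (Suc j))" by blast
  define N where "N j = fst (y j)" for j
  define h where "h j = fst (snd (y j))" for j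
  define s where "s j = snd (snd (y j))" for j
  have y_eq: "y j = (N j, h j, s j)" for j by (simp add: N_def h_def s_def)
  have N1: "1 \<le> N j" and block: "building_block (cube (N j)) (\<delta> j) (V j) (h j)"
    and s_avg: "L1_norm M (average T (N j) (s j)) \<le> \<alpha> j * \<delta> j / 4" and s_0: "s 0 = (\<lambda>_. 0)" for j
    using y(1)[of j] y(1)[of 0] by (simp_all add: P_def y_eq)
  have s_Suc: "s (Suc j) = (\<lambda>x. s j x + \<alpha> j * h j x)"
    and N_Suc: "N j < N (Suc j)" "growth (N j) \<le> N (Suc j)" for j
    using y(2)[of j] by (simp_all add: Q_def y_eq)
  define u where "u i x = \<alpha> i * h i x" for i x
  have s_eq: "s j x = (\<Sum>i<j. u i x)" for j x
    by (induction j) (simp_all add: s_0 s_Suc u_def)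
  have h_int: "integrable M (h j)" and h_0: "(\<integral>x. h j x \<partial>M) = 0" and h_norm: "L1_norm M (h j) \<le> 2"
    and h_inv: "\<And>w. w \<in> cube (N j) \<Longrightarrow> L1_norm M (\<lambda>x. h j (T w x) - h j x) \<le> \<delta> j / 4"
    and h_V: "\<And>g. integrable M g \<Longrightarrow> L1_norm M (\<lambda>x. g x - h j x) < \<delta> j \<Longrightarrow>
       L1_norm M g > 0 \<and> C0_functional (distribution M (\<lambda>x. g x / L1_norm M g)) \<in> V j" for j
    using block[of j] unfolding building_block_def by blast+
  have u_int: "integrable M (u i)" for i unfolding u_def[abs_def] using h_int by simp
  have u_norm: "L1_norm M (u i) \<le> 2 * \<alpha> i" for i
    unfolding u_def[abs_def] L1_norm_scale using h_norm[of i] \<alpha>_pos[of i] by simp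
  have geo: "(\<lambda>i. c * (1 / 16) ^ i) sums (c * (16 / 15))" for c :: real
    using sums_mult[OF geometric_sums[of "1 / 16 :: real"], of c] by simp
  have tail_le: "L1_norm M (u (i + Suc j)) \<le> \<alpha> j * \<delta> j / 8 * (1 / 16) ^ i" for i j
    using u_norm[of "i + Suc j"] \<alpha>_decay[of i j] by linarith
  have "summable (\<lambda>i. L1_norm M (u (i + 1)))"
    by (rule summable_comparison_test'[OF sums_summable[OF geo[of "\<alpha> 0 * \<delta> 0 / 8"]]])
      (use tail_le[of _ 0] in \<open>simp add: L1_norm_nonneg\<close>)
  then have u_sm: "summable (\<lambda>i. L1_norm M (u i))" using summable_iff_shift[of "\<lambda>i. L1_norm M (u i)" 1] by blast
  define f where "f x = (\<Sum>i. u i x)" for x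
  have f_int: "integrable M f" unfolding f_def[abs_def] by (rule L1_series(1)[OF u_int u_sm])
  have "(\<lambda>i. \<integral>x. u i x \<partial>M) sums (\<integral>x. f x \<partial>M)"
    unfolding f_def by (rule L1_series(2)[OF u_int u_sm])
  moreover have "(\<integral>x. u i x \<partial>M) = 0" for i by (simp add: u_def h_0)
  ultimately have f_0: "(\<integral>x. f x \<partial>M) = 0" by (simp add: sums_iff)
  have tail: "L1_norm M (\<lambda>x. f x - s (Suc j) x) \<le> \<alpha> j * \<delta> j / 4" for j
  proof -
    have "L1_norm M (\<lambda>x. f x - s (Suc j) x) \<le> (\<Sum>i. L1_norm M (u (i + Suc j)))"
      unfolding f_def s_eq by (rule L1_series(3)[OF u_int u_sm])
    also have "\<dots> \<le> (\<Sum>i. \<alpha> j * \<delta> j / 8 * (1 / 16) ^ i)"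
      using summable_iff_shift[of "\<lambda>i. L1_norm M (u i)" "Suc j"] u_sm
      by (intro suminf_le tail_le sums_summable[OF geo]) auto
    also have "\<dots> = \<alpha> j * \<delta> j / 8 * (16 / 15)" using geo by (rule sums_unique[symmetric])
    also have "\<dots> \<le> \<alpha> j * \<delta> j / 4" using \<alpha>_pos[of j] \<delta>(1)[of j] by simp
    finally show ?thesis .
  qed
  have main: "L1_norm M (average T (N j) f) > 0 \<and>
      C0_functional (distribution M (\<lambda>x. average T (N j) f x / L1_norm M (average T (N j) f))) \<in> V j" for j
  proof -
    let ?A = "average T (N j)"
    define g where "g x = ?A f x / \<alpha> j" for x
    have g: "integrable M g" unfolding g_def[abs_def] using integrable_average[OF f_int] by simp
    define t where "t x = f x - s (Suc j) x" for x
    have s_int: "integrable M (s i)" for i unfolding s_eq[abs_def] using u_int by auto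
    have t: "integrable M t" unfolding t_def[abs_def] using f_int s_int by auto
    \<comment> \<open>The split into earlier terms, the current term and the tail
      \<open>t\<close>.\<close>
    have "f = (\<lambda>x. s j x + (\<alpha> j * h j x + t x))" by (simp add: t_def s_Suc fun_eq_iff)
    then have "?A f x = ?A (\<lambda>x. s j x + (\<alpha> j * h j x + t x)) x" for x by (rule arg_cong)
    then have "?A f x = ?A (s j) x + (\<alpha> j * ?A (h j) x + ?A t x)" for x
      by (simp only: average_add average_scale)
    then have "g x - h j x = 1 / \<alpha> j * ?A (s j) x + ((?A (h j) x - h j x) + 1 / \<alpha> j * ?A t x)" for x
      using \<alpha>_pos[of j] by (simp add: g_def field_simps)
    then have "L1_norm M (\<lambda>x. g x - h j x)
        = L1_norm M (\<lambda>x. 1 / \<alpha> j * ?A (s j) x + ((?A (h j) x - h j x) + 1 / \<alpha> j * ?A t x))" by (simp only:)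
    also have "\<dots> \<le> L1_norm M (\<lambda>x. 1 / \<alpha> j * ?A (s j) x)
        + L1_norm M (\<lambda>x. (?A (h j) x - h j x) + 1 / \<alpha> j * ?A t x)"
      by (intro L1_norm_add_le Bochner_Integration.integrable_add Bochner_Integration.integrable_diff
          integrable_mult_right integrable_average s_int h_int t)
    also have "L1_norm M (\<lambda>x. (?A (h j) x - h j x) + 1 / \<alpha> j * ?A t x)
        \<le> L1_norm M (\<lambda>x. ?A (h j) x - h j x) + L1_norm M (\<lambda>x. 1 / \<alpha> j * ?A t x)"
      by (intro L1_norm_add_le Bochner_Integration.integrable_diff
          integrable_mult_right integrable_average h_int t)
    also have "L1_norm M (\<lambda>x. ?A (h j) x - h j x) \<le> \<delta> j / 4"
      by (rule L1_norm_average_diff_le[OF h_int N1 h_inv])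
    also have "L1_norm M (\<lambda>x. 1 / \<alpha> j * ?A (s j) x) \<le> \<delta> j / 4"
      using s_avg[of j] \<alpha>_pos[of j] by (simp only: L1_norm_scale) (simp add: field_simps)
    also have "L1_norm M (\<lambda>x. 1 / \<alpha> j * ?A t x) \<le> \<delta> j / 4"
      using L1_norm_average_le[OF t N1[of j]] tail[of j, folded t_def] \<alpha>_pos[of j]
      by (simp only: L1_norm_scale) (simp add: field_simps)
    finally have "L1_norm M (\<lambda>x. g x - h j x) < \<delta> j" using \<delta>(1)[of j] by simp
    from h_V[OF g this] have gV: "L1_norm M g > 0"
      "C0_functional (distribution M (\<lambda>x. g x / L1_norm M g)) \<in> V j" by blast+
    have "?A f = (\<lambda>x. \<alpha> j * g x)" using \<alpha>_pos[of j] by (simp add: g_def fun_eq_iff)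
    then have "L1_norm M (?A f) = \<alpha> j * L1_norm M g"
      using \<alpha>_pos[of j] by (simp add: L1_norm_scale)
    moreover have "?A f x / (\<alpha> j * L1_norm M g) = g x / L1_norm M g" for x
      by (simp add: g_def)
    ultimately show ?thesis using gV \<alpha>_pos[of j] by simp
  qed
  show ?thesis using f_int f_0 N1 N_Suc main by blast
qed

end

(* The hypothesis that every d j has integral 0 is forced by the conclusion:
   see integral_zero_necessary. *)
theorem mainTheorem1:
  fixes M :: "'a measure"
    and T :: "int ^ 'd \<Rightarrow> 'a \<Rightarrow> 'a"
    and d :: "nat \<Rightarrow> 'a \<Rightarrow> real"
    and U :: "nat \<Rightarrow> ((real \<Rightarrow> real) \<Rightarrow> real) set"
    and growth :: "nat \<Rightarrow> nat"
  assumes "lebesgue_prob_space M"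
    and "zd_action M T"
    and "free_action M T"
    and "ergodic_action M T"
    and "\<And>j. j \<ge> 1 \<Longrightarrow> integrable M (d j)"
    and "\<And>j. j \<ge> 1 \<Longrightarrow> L1_norm M (d j) = 1"
    and "\<And>j. j \<ge> 1 \<Longrightarrow> (\<integral>x. d j x \<partial>M) = 0"
    and "\<And>j. j \<ge> 1 \<Longrightarrow> weak_star_nbhd (U j) (distribution M (d j))"
  shows "\<exists>(f :: 'a \<Rightarrow> real) (N :: nat \<Rightarrow> nat).
    integrable M f \<and> (\<integral>x. f x \<partial>M) = 0 \<and>
    (\<forall>j\<ge>1. 1 \<le> N j \<and> N j < N (Suc j) \<and> growth (N j) \<le> N (Suc j)) \<and>
    (\<forall>j\<ge>1. L1_norm M (average T (N j) f) > 0 \<and>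
       C0_functional (distribution M (\<lambda>x. average T (N j) f x / L1_norm M (average T (N j) f))) \<in> U j)"
proof -
  interpret prob_space M using assms(1) by (simp add: lebesgue_prob_space_def)
  interpret lattice_action M T by unfold_locales fact
  \<comment> \<open>The construction is indexed from 0 and the statement from 1, hence
    \<open>Suc j\<close> here and \<open>j - 1\<close> at the end.\<close>
  have "\<exists>\<delta>>0. \<delta> \<le> 1 \<and> (\<forall>F. finite F \<longrightarrow> (\<exists>h. building_block F \<delta> (U (Suc j)) h))" for j
    by (rule building_block_exists[of "d (Suc j)"]) (use assms in auto)
  then obtain \<delta> where \<delta>: "\<And>j. 0 < \<delta> j" "\<And>j. \<delta> j \<le> 1"
    "\<forall>j F. finite F \<longrightarrow> (\<exists>h. building_block F (\<delta> j) (U (Suc j)) h)" by metis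
  from averages_with_prescribed_distributions[where V = "\<lambda>j. U (Suc j)" and growth = growth, OF \<delta>] obtain f N where
    f: "integrable M f" "(\<integral>x. f x \<partial>M) = 0" and N: "\<forall>j. 1 \<le> N j \<and> N j < N (Suc j) \<and> growth (N j) \<le> N (Suc j) \<and>
       L1_norm M (average T (N j) f) > 0 \<and>
       C0_functional (distribution M (\<lambda>x. average T (N j) f x / L1_norm M (average T (N j) f))) \<in> U (Suc j)"
    by (elim exE conjE)
  have "1 \<le> N (j - 1) \<and> N (j - 1) < N (Suc j - 1) \<and> growth (N (j - 1)) \<le> N (Suc j - 1)"
    "L1_norm M (average T (N (j - 1)) f) > 0 \<and>
       C0_functional (distribution M (\<lambda>x. average T (N (j - 1)) f x / L1_norm M (average T (N (j - 1)) f))) \<in> U j"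
    if "j \<ge> 1" for j
    using N[rule_format, of "j - 1"] that by simp_all
  with f show ?thesis by (intro exI[of _ f] exI[of _ "\<lambda>j. N (j - 1)"]) simp
qed

end
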